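(* Let $\lambda$ be an uncountable cardinal and assume (i) $\mu^{\omega}=\mu^+$ for each cardinal $\mu<\lambda$ with $\operatorname{cf}(\mu)=\omega$, and (ii) $\Box_\mu$ holds for each singular cardinal $\mu<\lambda$ with $\operatorname{cf}(\mu)=\omega$. Then $[\lambda,\kappa,\omega]\Rightarrow\omega_1$ holds whenever $\omega_1\le\kappa\le\lambda$.
   Context: $\Box_\mu$ is Jensen's square principle. For a function $f$ and set $A$, $I_f(A)=\{\xi\in\operatorname{ran}(f):|A\cap f^{-1}\{\xi\}|=1\}$. A $(\lambda,\kappa,\mu)$-system is a family $\mathcal A$ with $|\mathcal A|=\lambda$, $|A|=\kappa$ for all $A\in\mathcal A$, and $|A\cap A'|<\mu$ for distinct $A,A'\in\mathcal A$. For cardinals $\lambda\ge\kappa\ge\rho\ge\omega$ and $\mu\le\kappa$, $[\lambda,\kappa,\mu]\Rightarrow\rho$ means: for every $(\lambda,\kappa,\mu)$-system $\mathcal A$ there is $f:\bigcup\mathcal A\to\rho$ with $|\rho\setminus I_f(A)|<\rho$ for all $A\in\mathcal A$. *)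

theory Defs
  imports Main "HOL-Library.Countable_Set"
begin

text \<open>Ordinals are represented by well-orders (relations); a cardinal \<mu> is represented
by a set M via its cardinal order card_of M.  Strict order below:\<close>

definition lt :: "'a rel \<Rightarrow> 'a \<Rightarrow> 'a \<Rightarrow> bool" where
  "lt W x y \<longleftrightarrow> (x, y) \<in> W \<and> x \<noteq> y"

definition cofinal_in :: "'a rel \<Rightarrow> 'a set \<Rightarrow> bool" where
  "cofinal_in r S \<longleftrightarrow> S \<subseteq> Field r \<and> (\<forall>a\<in>Field r. \<exists>b\<in>S. (a, b) \<in> r)"

definition cf_omega :: "'a set \<Rightarrow> bool" where
  "cf_omega M \<longleftrightarrow> (\<exists>S. cofinal_in (card_of M) S \<and> countable S)
                 \<and> \<not> (\<exists>S. cofinal_in (card_of M) S \<and> finite S)"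

definition singular_card :: "'a set \<Rightarrow> bool" where
  "singular_card M \<longleftrightarrow> (\<exists>S. cofinal_in (card_of M) S \<and> ordLess2 (card_of S) (card_of M))"

definition is_limit :: "'a rel \<Rightarrow> 'a \<Rightarrow> bool" where
  "is_limit W a \<longleftrightarrow> a \<in> Field W \<and> (\<exists>b. lt W b a) \<and> (\<forall>b. lt W b a \<longrightarrow> (\<exists>c. lt W b c \<and> lt W c a))"

definition unbounded_below :: "'a rel \<Rightarrow> 'a \<Rightarrow> 'a set \<Rightarrow> bool" where
  "unbounded_below W a C \<longleftrightarrow> (\<forall>b. lt W b a \<longrightarrow> (\<exists>c\<in>C. (b, c) \<in> W \<and> lt W c a))"

definition club_below :: "'a rel \<Rightarrow> 'a \<Rightarrow> 'a set \<Rightarrow> bool" where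
  "club_below W a C \<longleftrightarrow> C \<subseteq> {b. lt W b a} \<and> unbounded_below W a C
     \<and> (\<forall>b. lt W b a \<and> is_limit W b \<and> unbounded_below W b C \<longrightarrow> b \<in> C)"

definition square :: "'a set \<Rightarrow> bool" where
  "square M \<longleftrightarrow> (let W = cardSuc (card_of M) in
     \<exists>C. \<forall>a. is_limit W a \<longrightarrow>
        club_below W a (C a)
        \<and> ordLeq3 (Restr W (C a)) (card_of M)
        \<and> (\<forall>b. lt W b a \<and> is_limit W b \<and> unbounded_below W b (C a)
                \<longrightarrow> C b = C a \<inter> {c. lt W c b}))"

definition I_f :: "('b \<Rightarrow> 'c) \<Rightarrow> 'c set \<Rightarrow> 'b set \<Rightarrow> 'c set" where
  "I_f f Rho A = {\<xi>\<in>Rho. \<exists>!x. x \<in> A \<and> f x = \<xi>}"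

definition is_system :: "'b set set \<Rightarrow> 'l rel \<Rightarrow> 'k rel \<Rightarrow> 'm rel \<Rightarrow> bool" where
  "is_system \<A> lam kap mu \<longleftrightarrow> ordIso2 (card_of \<A>) lam
     \<and> (\<forall>A\<in>\<A>. ordIso2 (card_of A) kap)
     \<and> (\<forall>A\<in>\<A>. \<forall>A'\<in>\<A>. A \<noteq> A' \<longrightarrow> ordLess2 (card_of (A \<inter> A')) mu)"

abbreviation omega1 :: "nat set set" where
  "omega1 \<equiv> Field (cardSuc natLeq)"

end

theory Submission
  imports Defs
begin

unbundle cardinal_syntax

text \<open>
  Induction on \<open>\<lambda>\<close>. An almost disjoint family \<open>\<A>\<close> of size \<open>\<lambda> > \<omega>\<^sub>1\<close> is cut into layers by an
  increasing chain \<open>U\<^sub>i\<close> of point sets of size \<open>< \<lambda>\<close> such that a set \<open>A \<in> \<A>\<close> with uncountable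
  trace on \<open>P\<^sub>i = \<Union>\<^sub>j\<^sub><\<^sub>i U\<^sub>j\<close> already has uncountable trace on some \<open>U\<^sub>j\<close> with \<open>j < i\<close>. Each \<open>A\<close> then
  has a first index \<open>i\<close> where its trace on \<open>U\<^sub>i\<close> is uncountable, it meets the earlier part in a
  countable set, and the colouring of the layer \<open>i\<close> is given by the induction hypothesis.

  The chain property matters at indices \<open>i\<close> of uncountable cofinality. There a countably infinite
  part of \<open>A \<inter> P\<^sub>i\<close> lies in one of fewer than \<open>\<lambda>\<close> sets handled before \<open>i\<close>, and almost disjointness
  recovers \<open>A\<close> from it. If \<open>\<lambda> = \<mu>\<^sup>+\<close> with \<open>cf \<mu> = \<omega> < \<mu>\<close>, a set of size \<open>\<mu>\<close> has too many
  countable subsets. So each \<open>P\<^sub>b\<close> is split into countably many pieces of size \<open>< \<mu>\<close>, and at a limit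
  \<open>k\<close> only the sets with infinite trace on \<open>\<Union>\<^sub>b\<^sub>\<in>\<^sub>C\<^sub>k (n-th piece of P\<^sub>b)\<close> are treated, where \<open>C\<close> is a
  square sequence. Coherence makes these suffice: every countable subset of \<open>C\<^sub>i\<close> is a subset of \<open>C\<^sub>k\<close>
  for a limit point \<open>k\<close> of \<open>C\<^sub>i\<close>.
\<close>

section \<open>Cardinalities and almost disjoint families\<close>

text \<open>The size is \<open>|Z|\<close> to the power omega; injective sequences stand in for
  countably infinite subsets.\<close>

abbreviation seqs :: "'a set \<Rightarrow> (nat \<Rightarrow> 'a) set" where
  "seqs Z \<equiv> {s. range s \<subseteq> Z}"

lemma seqs_eq_Func: "seqs Z = BNF_Wellorder_Constructions.Func (UNIV :: nat set) Z"
  by (auto simp: Func_def)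

lemma countable_iff_le_natLeq: "countable A \<longleftrightarrow> |A| \<le>o natLeq"
proof -
  have "countable A \<longleftrightarrow> |A| \<le>o |UNIV :: nat set|"
    unfolding countable_def card_of_ordLeq[symmetric] by auto
  then show ?thesis
    using card_of_nat ordLeq_ordIso_trans ordIso_symmetric by blast
qed

lemma uncountable_iff_omega1_le: "\<not> countable A \<longleftrightarrow> cardSuc natLeq \<le>o |A|"
  using countable_iff_le_natLeq[of A] cardSuc_ordLess_ordLeq[OF natLeq_Card_order card_of_Card_order]
    not_ordLeq_iff_ordLess[OF natLeq_Well_order card_of_Well_order] by blast

lemma uncountable_mono: "\<not> countable A \<Longrightarrow> |A| \<le>o |B| \<Longrightarrow> \<not> countable B"
  unfolding countable_iff_le_natLeq by (metis ordLeq_transitive)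

lemma countable_le_infinite: "countable A \<Longrightarrow> infinite B \<Longrightarrow> |A| \<le>o |B|"
  using infinite_iff_natLeq_ordLeq[of B]
  by (auto simp: countable_iff_le_natLeq intro: ordLeq_transitive)

lemma uncountable_infinite: "\<not> countable A \<Longrightarrow> infinite A"
  using countable_finite by blast

lemma card_le_or_less: "|A| \<le>o |B| \<or> |B| <o |A|"
  using ordLess_or_ordLeq[OF card_of_Well_order[of B] card_of_Well_order[of A]] by blast

lemma seqs_mono:
  assumes "|Z| \<le>o |T|"
  shows "|seqs Z| \<le>o |seqs T|"
proof -
  obtain g where g: "inj_on g Z" "g ` Z \<subseteq> T"
    using assms card_of_ordLeq[of Z T] by auto
  have "inj_on (\<lambda>s. g \<circ> s) (seqs Z)"
  proof (rule inj_onI)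
    fix s t assume "s \<in> seqs Z" "t \<in> seqs Z" and eq: "g \<circ> s = g \<circ> t"
    moreover have "g (s n) = g (t n)" for n using fun_cong[OF eq, of n] by simp
    ultimately have "s n = t n" for n
      using inj_onD[OF g(1), of "s n" "t n"] by (auto simp: image_subset_iff)
    then show "s = t" by auto
  qed
  moreover have "(\<lambda>s. g \<circ> s) s \<in> seqs T" if "s \<in> seqs Z" for s
    using that g(2) by auto
  ultimately show ?thesis by (rule card_of_ordLeqI)
qed

lemma UN_le:
  "infinite T \<Longrightarrow> |I| \<le>o |T| \<Longrightarrow> (\<And>i. i \<in> I \<Longrightarrow> |A i| \<le>o |T| ) \<Longrightarrow> |\<Union>i\<in>I. A i| \<le>o |T|"
  by (rule card_of_UNION_ordLeq_infinite) auto

lemma UN_nat_le: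
  assumes "infinite T" "\<And>n::nat. |A n| \<le>o |T|"
  shows "|\<Union>n. A n| \<le>o |T|"
  using assms by (intro UN_le countable_le_infinite[OF countableI_type])

lemma Un_le:
  assumes "infinite T" "|A| \<le>o |T|" "|B| \<le>o |T|"
  shows "|A \<union> B| \<le>o |T|"
proof -
  have "|\<Union>b\<in>(UNIV::bool set). if b then A else B| \<le>o |T|"
    using assms by (intro UN_le countable_le_infinite[OF countableI_type]) auto
  moreover have "(\<Union>b\<in>(UNIV::bool set). if b then A else B) = A \<union> B"
    by (auto split: if_splits)
  ultimately show ?thesis by simp
qed

text \<open>The common bound \<open>|B|\<close> takes the place of regularity: \<open>|M|\<close>
  may be singular, and the union is no larger than \<open>|I <+> B|\<close> once that sum is
  infinite.\<close>

lemma UN_less: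
  assumes M: "infinite M" and I: "|I| <o |M|" and B: "|B| <o |M|"
    and A: "\<And>i. i \<in> I \<Longrightarrow> |A i| \<le>o |B|"
  shows "|\<Union>i\<in>I. A i| <o |M|"
proof (cases "finite (I <+> B)")
  case True
  then have "finite (A i)" if "i \<in> I" for i
    using card_of_ordLeq_finite[OF A[OF that]] by auto
  with True have "finite (\<Union>i\<in>I. A i)" by auto
  then show ?thesis
    using M by (meson card_le_or_less card_of_ordLeq_finite)
next
  case False
  have "|A i| \<le>o |I <+> B|" if "i \<in> I" for i
    by (rule ordLeq_transitive[OF A[OF that] card_of_Plus2])
  then have "|\<Union>i\<in>I. A i| \<le>o |I <+> B|"
    using False by (intro UN_le card_of_Plus1)
  moreover have "|I <+> B| <o |M|"
    using M I B by (intro card_of_Plus_ordLess_infinite)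
  ultimately show ?thesis by (rule ordLeq_ordLess_trans)
qed

lemma Diff_same_card:
  assumes A: "infinite A" and B: "|B| <o |A|"
  shows "|A - B| =o |A|"
proof -
  have "|A| \<le>o |A - B|"
  proof (rule ccontr)
    assume "\<not> |A| \<le>o |A - B|"
    then have "|A - B| <o |A|" using card_le_or_less[of A "A - B"] by blast
    then have "|(A - B) \<union> B| <o |A|" using A B by (intro card_of_Un_ordLess_infinite)
    moreover have "|A| \<le>o |(A - B) \<union> B|" by (intro card_of_mono1) auto
    ultimately show False using not_ordLess_ordLeq by blast
  qed
  then show ?thesis by (simp add: ordIso_iff_ordLeq card_of_mono1)
qed

lemma infinite_omega1: "infinite omega1"
  using cardSuc_finite[OF natLeq_Card_order] by (simp add: Field_natLeq)

lemma card_omega1: "|omega1| =o cardSuc natLeq"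
  by (intro card_of_Field_ordIso cardSuc_Card_order natLeq_Card_order)

lemma uncountable_omega1: "\<not> countable omega1"
  unfolding uncountable_iff_omega1_le using card_omega1 ordIso_iff_ordLeq by blast

lemma countable_less_omega1: "countable X \<Longrightarrow> |X| <o |omega1|"
  using uncountable_mono[OF uncountable_omega1] card_le_or_less[of omega1 X] by blast

text \<open>Distinct members with infinite trace on \<open>Z\<close> are separated by any countably infinite
  part of the trace.\<close>

lemma card_infinite_traces:
  assumes ad: "pairwise (\<lambda>A B. finite (A \<inter> B)) \<A>"
  shows "|{A\<in>\<A>. infinite (A \<inter> Z)}| \<le>o |seqs Z|"
proof -
  have "\<exists>s :: nat \<Rightarrow> 'a. inj s \<and> range s \<subseteq> A \<inter> Z" if "infinite (A \<inter> Z)" for A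
    using that by (rule infinite_countable_subset)
  then obtain s :: "'a set \<Rightarrow> nat \<Rightarrow> 'a"
    where s: "\<And>A. infinite (A \<inter> Z) \<Longrightarrow> inj (s A) \<and> range (s A) \<subseteq> A \<inter> Z"
    by metis
  have "inj_on s {A\<in>\<A>. infinite (A \<inter> Z)}"
  proof (rule inj_onI, rule ccontr)
    fix A B
    assume A: "A \<in> {A\<in>\<A>. infinite (A \<inter> Z)}" and B: "B \<in> {A\<in>\<A>. infinite (A \<inter> Z)}"
      and eq: "s A = s B" and ne: "A \<noteq> B"
    have "range (s A) \<subseteq> A \<inter> B" using s[of A] s[of B] A B eq by auto
    moreover have "finite (A \<inter> B)" using ad A B ne by (auto simp: pairwise_def)
    ultimately have "finite (range (s A))" by (rule finite_subset)
    then show False using s[of A] A finite_imageD by auto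
  qed
  moreover have "s A \<in> seqs Z" if "A \<in> {A\<in>\<A>. infinite (A \<inter> Z)}" for A
    using s[of A] that by auto
  ultimately show ?thesis by (rule card_of_ordLeqI)
qed

section \<open>Uncountable traces and sets covered by pieces with few sequences\<close>

text \<open>When \<open>|T|\<close> has cofinality omega, a set of size \<open>|T|\<close> may have
  more than \<open>|T|\<close> sequences, but it can be cut into countably many smaller pieces.
  Bounding the sequences of each piece is enough, because an uncountable trace on \<open>Y\<close>
  is infinite on some piece.\<close>

definition seq_covered :: "'b set \<Rightarrow> 'l set \<Rightarrow> bool" where
  "seq_covered Y T \<longleftrightarrow> (\<exists>D :: nat \<Rightarrow> 'b set. Y \<subseteq> (\<Union>n. D n) \<and> (\<forall>n. |seqs (D n)| \<le>o |T| ))"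

lemma card_traces_on_pieces:
  assumes ad: "pairwise (\<lambda>A B. finite (A \<inter> B)) \<A>" and T: "infinite T"
    and D: "\<And>n. |seqs (D n)| \<le>o |T|"
  shows "|{A\<in>\<A>. \<exists>n::nat. infinite (A \<inter> D n)}| \<le>o |T|"
proof -
  have "{A\<in>\<A>. \<exists>n::nat. infinite (A \<inter> D n)} = (\<Union>n. {A\<in>\<A>. infinite (A \<inter> D n)})" by auto
  moreover have "|\<Union>n. {A\<in>\<A>. infinite (A \<inter> D n)}| \<le>o |T|"
    using T ordLeq_transitive[OF card_infinite_traces[OF ad] D] by (rule UN_nat_le)
  ultimately show ?thesis by simp
qed

lemma uncountable_trace_piece:
  assumes "\<not> countable (A \<inter> Y)" "Y \<subseteq> (\<Union>n::nat. D n)"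
  shows "\<exists>n. infinite (A \<inter> D n)"
proof (rule ccontr)
  assume "\<not> ?thesis"
  then have "countable (\<Union>n. A \<inter> D n)"
    by (intro countable_UN countableI_type) (simp add: countable_finite)
  moreover have "A \<inter> Y \<subseteq> (\<Union>n. A \<inter> D n)" using assms(2) by auto
  ultimately show False using assms(1) countable_subset by blast
qed

lemma card_uncountable_traces:
  assumes ad: "pairwise (\<lambda>A B. finite (A \<inter> B)) \<A>" and T: "infinite T"
    and Y: "seq_covered Y T"
  shows "|{A\<in>\<A>. \<not> countable (A \<inter> Y)}| \<le>o |T|"
proof -
  obtain D where D: "Y \<subseteq> (\<Union>n::nat. D n)" "\<And>n. |seqs (D n)| \<le>o |T|"
    using Y unfolding seq_covered_def by auto
  have "{A\<in>\<A>. \<not> countable (A \<inter> Y)} \<subseteq> {A\<in>\<A>. \<exists>n. infinite (A \<inter> D n)}"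
    using uncountable_trace_piece[OF _ D(1)] by blast
  then show ?thesis
    by (rule ordLeq_transitive[OF card_of_mono1 card_traces_on_pieces[OF ad T D(2)]])
qed

text \<open>Closing off omega times suffices: an uncountable trace on the union of the stages is
  already uncountable on one stage, and the next stage adds \<open>u A\<close>. Each stage stays
  small because at most \<open>|T|\<close> members have an uncountable trace on it.\<close>

lemma hull_exists:
  fixes Y :: "'b set" and T :: "'l set"
  assumes ad: "pairwise (\<lambda>A B. finite (A \<inter> B)) \<A>" and T: "infinite T"
    and cover: "\<And>Y :: 'b set. |Y| \<le>o |T| \<Longrightarrow> seq_covered Y T"
    and u: "\<And>A. A \<in> \<A> \<Longrightarrow> |u A| \<le>o |T|"
    and Y: "|Y| \<le>o |T|"
  shows "\<exists>H. Y \<subseteq> H \<and> |H| \<le>o |T| \<and> (\<forall>A\<in>\<A>. \<not> countable (A \<inter> H) \<longrightarrow> u A \<subseteq> H)"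
proof -
  define G where "G X = X \<union> (\<Union>A\<in>{A\<in>\<A>. \<not> countable (A \<inter> X)}. u A)" for X :: "'b set"
  define X where "X k = (G ^^ k) Y" for k
  have card_X: "|X k| \<le>o |T|" for k
  proof (induction k)
    case 0 then show ?case using Y by (simp add: X_def)
  next
    case (Suc k)
    have "|G (X k)| \<le>o |T|"
      unfolding G_def using Suc T u
      by (intro Un_le UN_le card_uncountable_traces[OF ad T] cover) auto
    then show ?case by (simp add: X_def)
  qed
  define H where "H = (\<Union>k. X k)"
  have "Y \<subseteq> H" unfolding H_def X_def by (metis UNIV_I UN_upper funpow_0)
  moreover have "|H| \<le>o |T|"
    unfolding H_def using T card_X by (rule UN_nat_le)
  moreover have "u A \<subseteq> H" if A: "A \<in> \<A>" "\<not> countable (A \<inter> H)" for A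
  proof -
    have "A \<inter> H = (\<Union>k. A \<inter> X k)" by (auto simp: H_def)
    then obtain k where "\<not> countable (A \<inter> X k)"
      using A(2) countable_UN[OF countableI_type, of UNIV "\<lambda>k. A \<inter> X k"] by auto
    then have "u A \<subseteq> X (Suc k)" using A(1) by (auto simp: X_def G_def)
    then show ?thesis by (auto simp: H_def)
  qed
  ultimately show ?thesis by blast
qed

section \<open>Colourings by omega1: gluing disjoint layers, and families of at most omega1
  sets\<close>

text \<open>Countability expresses that the exceptional set of colours has size below omega1. Every
  point of the type gets a colour, so colourings of different layers carry no domains.\<close>

definition colourable :: "'b set set \<Rightarrow> bool" where
  "colourable \<A> \<longleftrightarrow> (\<exists>f :: 'b \<Rightarrow> nat set. range f \<subseteq> omega1 \<and>
     (\<forall>A\<in>\<A>. countable (omega1 - I_f f omega1 A)))"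

text \<open>A colour is lost for \<open>A\<close>, whose own layer is \<open>i\<close>, for one of
  three reasons: it is lost within layer \<open>i\<close>, it is taken at one of the countably many
  points of \<open>A\<close> in other layers, or it is the default \<open>z\<close> used outside all
  layers.\<close>

lemma glue_colourings:
  fixes X :: "'i \<Rightarrow> 'b set" and f :: "'i \<Rightarrow> 'b \<Rightarrow> 'c"
  assumes R: "R \<noteq> {}"
    and disj: "\<And>i j. i \<in> I \<Longrightarrow> j \<in> I \<Longrightarrow> i \<noteq> j \<Longrightarrow> X i \<inter> X j = {}"
    and f: "\<And>i. i \<in> I \<Longrightarrow> range (f i) \<subseteq> R"
    and layer: "\<And>A. A \<in> \<A> \<Longrightarrow> \<exists>i\<in>I. countable (R - I_f (f i) R (A \<inter> X i)) \<and>
        countable (A \<inter> (\<Union>j\<in>I - {i}. X j))"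
  shows "\<exists>g. range g \<subseteq> R \<and> (\<forall>A\<in>\<A>. countable (R - I_f g R A))"
proof -
  obtain z where z: "z \<in> R" using R by blast
  define g where "g x = (if \<exists>i\<in>I. x \<in> X i then f (THE i. i \<in> I \<and> x \<in> X i) x else z)" for x
  have g_in: "g x = f i x" if "i \<in> I" "x \<in> X i" for i x
  proof -
    have "(THE i. i \<in> I \<and> x \<in> X i) = i"
    proof (rule the_equality)
      fix j assume "j \<in> I \<and> x \<in> X j"
      then show "j = i" using disj[of j i] that by blast
    qed (simp add: that)
    moreover have "\<exists>i\<in>I. x \<in> X i" using that by blast
    ultimately show ?thesis by (simp add: g_def)
  qed
  have g_out: "g x = z" if "\<And>i. i \<in> I \<Longrightarrow> x \<notin> X i" for x using that by (auto simp: g_def)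
  have "range g \<subseteq> R"
  proof (rule image_subsetI)
    fix x
    show "g x \<in> R"
    proof (cases "\<exists>i\<in>I. x \<in> X i")
      case True
      then obtain i where i: "i \<in> I" "x \<in> X i" by blast
      have "f i x \<in> R" using f[OF i(1)] by blast
      then show ?thesis using g_in[OF i] by simp
    next
      case False
      then show ?thesis using g_out z by auto
    qed
  qed
  moreover have "countable (R - I_f g R A)" if A: "A \<in> \<A>" for A
  proof -
    obtain i where i: "i \<in> I" "countable (R - I_f (f i) R (A \<inter> X i))"
      "countable (A \<inter> (\<Union>j\<in>I - {i}. X j))"
      using layer[OF A] by blast
    have "R - I_f g R A \<subseteq>
        (R - I_f (f i) R (A \<inter> X i)) \<union> g ` (A \<inter> (\<Union>j\<in>I - {i}. X j)) \<union> {z}"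
    proof
      fix \<xi> assume xi: "\<xi> \<in> R - I_f g R A"
      show "\<xi> \<in> (R - I_f (f i) R (A \<inter> X i)) \<union> g ` (A \<inter> (\<Union>j\<in>I - {i}. X j)) \<union> {z}"
      proof (rule ccontr)
        assume neg: "\<not> ?thesis"
        then obtain x where x: "x \<in> A" "x \<in> X i" "f i x = \<xi>"
          and uniq: "\<And>y. y \<in> A \<Longrightarrow> y \<in> X i \<Longrightarrow> f i y = \<xi> \<Longrightarrow> y = x"
        proof -
          have "\<xi> \<in> I_f (f i) R (A \<inter> X i)" using neg xi by blast
          then show thesis using that unfolding I_f_def by blast
        qed
        have "y = x" if y: "y \<in> A" "g y = \<xi>" for y
        proof -
          have "\<exists>j\<in>I. y \<in> X j" using g_out[of y] y neg by auto
          then obtain j where j: "j \<in> I" "y \<in> X j" by blast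
          have "j = i" using neg y j by auto
          then show ?thesis using uniq[of y] g_in[of j y] j y by auto
        qed
        moreover have "g x = \<xi>" using g_in i x by auto
        ultimately have "\<xi> \<in> I_f g R A"
          using x(1) xi unfolding I_f_def by blast
        then show False using xi by auto
      qed
    qed
    then show ?thesis
      by (rule countable_subset) (intro countable_Un countable_image i(2,3) countable_finite[of "{z}"], simp)
  qed
  ultimately show ?thesis by blast
qed

lemma I_f_bij_betw:
  assumes "bij_betw f A R"
  shows "I_f f R A = R"
proof (intro equalityI subsetI)
  fix y assume y: "y \<in> R"
  then obtain x where "x \<in> A" "f x = y" using assms by (auto simp: bij_betw_def)
  moreover have "z = x" if "z \<in> A" "f z = y" for z
    using assms that calculation by (auto simp: bij_betw_def dest: inj_onD)
  ultimately show "y \<in> I_f f R A" using y by (auto simp: I_f_def)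
qed (simp add: I_f_def)

lemma underS_card_countable:
  assumes "|\<A>| \<le>o cardSuc natLeq" "A \<in> \<A>"
  shows "countable (underS |\<A>| A)"
proof -
  have "|underS |\<A>| A| <o |\<A>|"
    using assms(2) by (intro card_of_underS card_of_Card_order) (simp add: Field_card_of)
  from ordLess_ordLeq_trans[OF this assms(1)] show ?thesis
    unfolding countable_iff_le_natLeq cardSuc_ordLeq_ordLess[OF natLeq_Card_order card_of_Card_order] .
qed

text \<open>The family is well-ordered in type at most omega1. A set has countably many predecessors
  and meets each in a finite set, so its remainder \<open>X A\<close> still has size omega1 and can
  be mapped bijectively onto \<open>omega1\<close>. A set misses the remainders of all later sets,
  hence has only countably many points in remainders other than its own.\<close>

lemma colourable_omega1:
  fixes \<A> :: "'b set set"
  assumes ad: "pairwise (\<lambda>A B. finite (A \<inter> B)) \<A>" and card: "|\<A>| \<le>o cardSuc natLeq"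
    and size: "\<And>A. A \<in> \<A> \<Longrightarrow> |A| =o cardSuc natLeq"
  shows "colourable \<A>"
proof -
  define X where "X A = A - \<Union>(underS |\<A>| A)" for A
  interpret wo: wo_rel "|\<A>|" by (simp add: wo_rel_def card_of_Well_order)
  have sub: "underS |\<A>| A \<subseteq> \<A>" for A
    using Field_card_of[of \<A>] unfolding underS_def Field_def by auto
  have ctble: "countable (A \<inter> \<Union>(underS |\<A>| A))" if A: "A \<in> \<A>" for A
  proof -
    have "finite (A \<inter> B)" if "B \<in> underS |\<A>| A" for B
      using ad A sub[of A] that by (auto simp: pairwise_def underS_def)
    then have "countable (\<Union>B\<in>underS |\<A>| A. A \<inter> B)"
      using A by (intro countable_UN underS_card_countable[OF card A] countable_finite)
    then show ?thesis by (simp only: Int_Union)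
  qed
  have less: "A \<in> underS |\<A>| B \<or> B \<in> underS |\<A>| A" if "A \<in> \<A>" "B \<in> \<A>" "A \<noteq> B" for A B
    using wo.TOTALS that by (auto simp: underS_def Field_card_of)
  have "|X A| =o |omega1|" if A: "A \<in> \<A>" for A
  proof -
    have unc: "\<not> countable A"
      unfolding uncountable_iff_omega1_le using size[OF A] ordIso_iff_ordLeq by blast
    have "X A = A - (A \<inter> \<Union>(underS |\<A>| A))" by (auto simp: X_def)
    moreover have "|A \<inter> \<Union>(underS |\<A>| A)| <o |A|"
      using ctble[OF A] uncountable_mono[OF unc] card_le_or_less[of A] by blast
    ultimately have "|X A| =o |A|"
      using Diff_same_card uncountable_infinite[OF unc] by fastforce
    then show ?thesis by (rule ordIso_transitive[OF _ ordIso_transitive[OF size[OF A] ordIso_symmetric[OF card_omega1]]])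
  qed
  then have "\<exists>f. bij_betw f (X A) omega1" if "A \<in> \<A>" for A
    using that card_of_ordIso by blast
  then obtain f where f: "\<And>A. A \<in> \<A> \<Longrightarrow> bij_betw (f A) (X A) omega1" by metis
  obtain z where z: "z \<in> omega1" using infinite_imp_nonempty[OF infinite_omega1] by blast
  \<comment> \<open>The bijection controls \<open>f A\<close> on \<open>X A\<close> only; the
    default \<open>z\<close> elsewhere brings the whole range into \<open>omega1\<close>.\<close>
  define g where "g A x = (if x \<in> X A then f A x else z)" for A x
  have g: "bij_betw (g A) (X A) omega1" if "A \<in> \<A>" for A
    using f[OF that] by (rule bij_betw_cong[THEN iffD1, rotated]) (simp add: g_def)
  show ?thesis
    unfolding colourable_def
  proof (rule glue_colourings)
    show "omega1 \<noteq> {}" using z by blast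
    show "X A \<inter> X B = {}" if "A \<in> \<A>" "B \<in> \<A>" "A \<noteq> B" for A B
      using less[OF that] unfolding X_def by blast
    show "range (g A) \<subseteq> omega1" if "A \<in> \<A>" for A
      using f[OF that] z by (auto simp: g_def bij_betw_def)
    show "\<exists>B\<in>\<A>. countable (omega1 - I_f (g B) omega1 (A \<inter> X B)) \<and>
        countable (A \<inter> (\<Union>C\<in>\<A> - {B}. X C))" if A: "A \<in> \<A>" for A
    proof (intro bexI conjI)
      have "A \<inter> X A = X A" by (auto simp: X_def)
      then show "countable (omega1 - I_f (g A) omega1 (A \<inter> X A))"
        using I_f_bij_betw[OF g[OF A]] by simp
      have "A \<inter> X C = {}" if "C \<in> \<A>" "A \<in> underS |\<A>| C" for C
        using that by (auto simp: X_def)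
      then have "A \<inter> (\<Union>C\<in>\<A> - {A}. X C) \<subseteq> A \<inter> \<Union>(underS |\<A>| A)"
        using less[OF A] by (fastforce simp: X_def)
      then show "countable (A \<inter> (\<Union>C\<in>\<A> - {A}. X C))"
        using ctble[OF A] countable_subset by blast
    qed (rule A)
  qed
qed

section \<open>Colouring along a filtration\<close>

abbreviation below :: "'i rel \<Rightarrow> ('i \<Rightarrow> 'b set) \<Rightarrow> 'i \<Rightarrow> 'b set" where
  "below W U i \<equiv> \<Union>(U ` underS W i)"

text \<open>\<open>T i\<close> bounds the sizes at level \<open>i\<close>, and the
  \<open>Z U i n\<close> are test sets: a member with infinite trace on one of them is treated at
  stage \<open>i\<close>. By \<open>Z_local\<close> they are known when \<open>U i\<close> is
  chosen. \<open>capture\<close> concerns indices of uncountable cofinality, where an uncountable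
  trace on the earlier part must be detected by an earlier test set.\<close>

locale filtration =
  fixes W :: "'i rel" and T :: "'i \<Rightarrow> 'l set" and Z :: "('i \<Rightarrow> 'b set) \<Rightarrow> 'i \<Rightarrow> nat \<Rightarrow> 'b set"
  assumes W: "Well_order W"
    and uncountable_T: "i \<in> Field W \<Longrightarrow> \<not> countable (T i)"
    and card_underS: "i \<in> Field W \<Longrightarrow> |underS W i| \<le>o |T i|"
    and T_mono: "(i, j) \<in> W \<Longrightarrow> |T i| \<le>o |T j|"
    and cover: "\<And>Y :: 'b set. i \<in> Field W \<Longrightarrow> |Y| \<le>o |T i| \<Longrightarrow> seq_covered Y (T i)"
    and Z_local: "(\<And>j. j \<in> underS W i \<Longrightarrow> U j = U' j) \<Longrightarrow> Z U i = Z U' i"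
    and Z_card: "i \<in> Field W \<Longrightarrow> (\<And>j. j \<in> underS W i \<Longrightarrow> |U j| \<le>o |T j| ) \<Longrightarrow>
      |seqs (Z U i n)| \<le>o |T i|"
    and capture: "i \<in> Field W \<Longrightarrow>
      (\<And>j. j \<in> Field W \<Longrightarrow> below W U j \<subseteq> U j) \<Longrightarrow>
      (\<And>j. j \<in> Field W \<Longrightarrow> |U j| \<le>o |T j| ) \<Longrightarrow>
      (\<And>J. J \<subseteq> underS W i \<Longrightarrow> countable J \<Longrightarrow> \<exists>k\<in>underS W i. J \<subseteq> underS W k) \<Longrightarrow>
      \<not> countable (A \<inter> below W U i) \<Longrightarrow>
      \<exists>k\<in>underS W i. \<exists>n. infinite (A \<inter> Z U k n)"
begin

lemma infinite_T: "i \<in> Field W \<Longrightarrow> infinite (T i)"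
  using uncountable_T by (rule uncountable_infinite)

lemma underS_Field: "j \<in> underS W i \<Longrightarrow> j \<in> Field W"
  by (auto simp: underS_def Field_def)

lemma T_mono_underS: "j \<in> underS W i \<Longrightarrow> |T j| \<le>o |T i|"
  using T_mono by (auto simp: underS_def)

lemma card_below:
  assumes i: "i \<in> Field W" and U: "\<And>j. j \<in> underS W i \<Longrightarrow> |U j| \<le>o |T j|"
  shows "|below W U i| \<le>o |T i|"
  using infinite_T[OF i] card_underS[OF i]
  by (rule UN_le) (rule ordLeq_transitive[OF U T_mono_underS])

lemma below_mono:
  assumes "\<And>j. j \<in> Field W \<Longrightarrow> below W U j \<subseteq> U j" "(i, j) \<in> W"
  shows "U i \<subseteq> U j"
proof (cases "i = j")
  case False
  then have "i \<in> underS W j" using assms(2) by (simp add: underS_def)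
  moreover have "j \<in> Field W" using assms(2) by (auto simp: Field_def)
  ultimately show ?thesis using assms(1) by blast
qed simp

lemma not_underS: "i \<in> Field W \<Longrightarrow> j \<in> Field W \<Longrightarrow> i \<notin> underS W j \<Longrightarrow> (j, i) \<in> W"
proof -
  interpret wo_rel W by (simp add: wo_rel_def W)
  show "i \<in> Field W \<Longrightarrow> j \<in> Field W \<Longrightarrow> i \<notin> underS j \<Longrightarrow> (j, i) \<in> W"
    using TOTALS by (auto simp: underS_def)
qed

text \<open>Well-founded recursion: stage \<open>i\<close> collects the earlier levels and the
  \<open>u\<close>-parts of \<open>r i\<close> and of the sets detected by \<open>Z U i\<close>,
  then closes off by \<open>hull_exists\<close>. \<open>Z_card\<close> keeps the detected sets few.
  In the application \<open>r\<close> enumerates the family, so every member is treated at some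
  stage.\<close>

lemma chain_exists:
  fixes \<A> :: "'b set set" and r :: "'i \<Rightarrow> 'b set" and u :: "'i \<Rightarrow> 'b set \<Rightarrow> 'b set \<Rightarrow> 'b set"
  assumes ad: "pairwise (\<lambda>A B. finite (A \<inter> B)) \<A>"
    and u: "\<And>i P A. i \<in> Field W \<Longrightarrow> A \<in> \<A> \<Longrightarrow> |u i P A| \<le>o |T i|"
    and r: "\<And>i. i \<in> Field W \<Longrightarrow> r i \<in> \<A>"
  shows "\<exists>U. \<forall>i\<in>Field W. below W U i \<subseteq> U i \<and> |U i| \<le>o |T i| \<and>
    (\<forall>A\<in>\<A>. \<not> countable (A \<inter> U i) \<or> (\<exists>n. infinite (A \<inter> Z U i n)) \<or> A = r i \<longrightarrow>
      u i (below W U i) A \<subseteq> U i)"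
proof -
  \<comment> \<open>The size bound below \<open>i\<close> is a premise inside \<open>Q\<close>, so
    that a suitable \<open>S\<close> exists for every \<open>U\<close>, as the choice principle
    demands; the bound itself follows by induction once \<open>U\<close> is fixed.\<close>
  define Q where "Q U i S \<longleftrightarrow> (i \<in> Field W \<longrightarrow> (\<forall>j\<in>underS W i. |U j| \<le>o |T j| ) \<longrightarrow>
      below W U i \<subseteq> S \<and> |S| \<le>o |T i| \<and>
      (\<forall>A\<in>\<A>. \<not> countable (A \<inter> S) \<or> (\<exists>n. infinite (A \<inter> Z U i n)) \<or> A = r i \<longrightarrow>
        u i (below W U i) A \<subseteq> S))" for U i S
  interpret wo: wo_rel W by (simp add: wo_rel_def W)
  have "\<exists>U. \<forall>i. Q U i (U i)"
  proof (rule dependent_wf_choice[OF wo.WF])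
    fix U U' :: "'i \<Rightarrow> 'b set" and i S
    assume "\<And>j. (j, i) \<in> W - Id \<Longrightarrow> U j = U' j"
    then have eq: "U j = U' j" if "j \<in> underS W i" for j
      using that by (simp add: underS_def)
    have "below W U i = below W U' i" using eq by auto
    moreover have "Z U i = Z U' i" using eq by (rule Z_local)
    ultimately show "Q U i S = Q U' i S"
      unfolding Q_def using eq by simp
  next
    fix i and U :: "'i \<Rightarrow> 'b set"
    show "\<exists>S. Q U i S"
    proof (cases "i \<in> Field W \<and> (\<forall>j\<in>underS W i. |U j| \<le>o |T j| )")
      case True
      then have i: "i \<in> Field W" and U: "\<And>j. j \<in> underS W i \<Longrightarrow> |U j| \<le>o |T j|" by auto
      define N where "N = {A\<in>\<A>. \<exists>n. infinite (A \<inter> Z U i n)} \<union> {r i}"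
      define Y where "Y = below W U i \<union> (\<Union>A\<in>N. u i (below W U i) A)"
      have "|N| \<le>o |T i|"
        unfolding N_def
        by (rule Un_le[OF infinite_T[OF i] card_traces_on_pieces[OF ad infinite_T[OF i] Z_card[OF i U]]
              countable_le_infinite[OF _ infinite_T[OF i]]]) auto
      moreover have "N \<subseteq> \<A>" using r[OF i] by (auto simp: N_def)
      ultimately have "|Y| \<le>o |T i|"
        unfolding Y_def
        by (intro Un_le[OF infinite_T[OF i] card_below[OF i U] UN_le[OF infinite_T[OF i]]])
           (use u[OF i] in auto)
      from hull_exists[where u = "u i (below W U i)", OF ad infinite_T[OF i] cover[OF i] u[OF i] this]
      obtain S where S: "Y \<subseteq> S" "|S| \<le>o |T i|"
        "\<forall>A\<in>\<A>. \<not> countable (A \<inter> S) \<longrightarrow> u i (below W U i) A \<subseteq> S"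
        by blast
      have "u i (below W U i) A \<subseteq> S" if "A \<in> N" for A
        using that S(1) by (auto simp: Y_def)
      then have "Q U i S"
        using S unfolding Q_def N_def Y_def by auto
      then show ?thesis ..
    next
      case False
      then show ?thesis by (auto simp: Q_def)
    qed
  qed
  then obtain U where Q: "\<And>i. Q U i (U i)" by blast
  have card_U: "i \<in> Field W \<longrightarrow> |U i| \<le>o |T i|" for i
  proof (induction i rule: wo.well_order_induct)
    case (1 i)
    then have "\<forall>j\<in>underS W i. |U j| \<le>o |T j|" using underS_Field by (auto simp: underS_def)
    then show ?case using Q[of i] unfolding Q_def by blast
  qed
  have U: "\<forall>j\<in>underS W i. |U j| \<le>o |T j|" for i using card_U underS_Field by blast
  show ?thesis
  proof (intro exI[of _ U] ballI)
    fix i assume "i \<in> Field W"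
    then show "below W U i \<subseteq> U i \<and> |U i| \<le>o |T i| \<and>
      (\<forall>A\<in>\<A>. \<not> countable (A \<inter> U i) \<or> (\<exists>n. infinite (A \<inter> Z U i n)) \<or> A = r i \<longrightarrow>
        u i (below W U i) A \<subseteq> U i)"
      using Q[of i, unfolded Q_def, rule_format, OF _ U[of i, rule_format]] by simp
  qed
qed

text \<open>The layer \<open>X i\<close> avoids every set that is already uncountable on the earlier levels,
  so a set meets only its own layer and countably much of the earlier ones.\<close>

lemma colourable_step:
  fixes L K :: "'l set" and \<A> :: "'b set set"
  assumes T_less: "\<And>i. i \<in> Field W \<Longrightarrow> |T i| <o |L|"
    and L_le: "|L| \<le>o |Field W|"
    and K_le: "\<And>i. i \<in> Field W \<Longrightarrow> |K| <o |L| \<Longrightarrow> |K| \<le>o |T i|"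
    and K: "\<not> countable K"
    and ad: "pairwise (\<lambda>A B. finite (A \<inter> B)) \<A>"
    and card: "|\<A>| \<le>o |L|"
    and size: "\<And>A. A \<in> \<A> \<Longrightarrow> |A| =o |K|"
    and IH: "\<And>i (K' :: 'l set) (\<B> :: 'b set set). i \<in> Field W \<Longrightarrow> \<not> countable K' \<Longrightarrow> |K'| \<le>o |T i| \<Longrightarrow>
      pairwise (\<lambda>A B. finite (A \<inter> B)) \<B> \<Longrightarrow> |\<B>| \<le>o |T i| \<Longrightarrow>
      (\<And>B. B \<in> \<B> \<Longrightarrow> |B| =o |K'| ) \<Longrightarrow> colourable \<B>"
  shows "colourable \<A>"
proof (cases "\<A> = {}")
  case True
  obtain z where "z \<in> omega1" using infinite_imp_nonempty[OF infinite_omega1] by blast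
  then have "range (\<lambda>_. z) \<subseteq> omega1" by auto
  then show ?thesis unfolding colourable_def True by blast
next
  case False
  interpret wo: wo_rel W by (simp add: wo_rel_def W)
  obtain r where r: "r ` Field W = \<A>"
    using card_of_ordLeq2[OF False, of "Field W"] ordLeq_transitive[OF card L_le] by blast
  define active where "active P = {A\<in>\<A>. \<not> countable (A \<inter> P)}" for P
  have unc: "\<not> countable A" if "A \<in> \<A>" for A
    using uncountable_mono[OF K] size[OF that] ordIso_iff_ordLeq by blast
  \<comment> \<open>If \<open>|K| <o |L|\<close>, all of \<open>A\<close> fits into a level.
    Otherwise \<open>A\<close> is too large, and only a part of size \<open>|T i|\<close> is added,
    chosen off \<open>P\<close> and off all sets active on \<open>P\<close> so that it falls into
    the new layer. If \<open>P\<close> is too large or the trace of \<open>A\<close> on it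
    uncountable, the second clause is void.\<close>
  define ok where "ok i P A V \<longleftrightarrow> V \<subseteq> A \<and> |V| \<le>o |T i| \<and>
      ( |P| \<le>o |T i| \<and> countable (A \<inter> P) \<longrightarrow> \<not> countable V \<and>
        (if |K| <o |L| then V = A else V \<inter> P = {} \<and> V \<inter> \<Union>(active P) = {} \<and> |V| =o |T i| ))"
    for i P A V
  have ok: "\<exists>V. ok i P A V"
    if i: "i \<in> Field W" and A: "A \<in> \<A>" for i P A
  proof (cases "|K| <o |L|")
    case True
    then have "|A| \<le>o |T i|" using K_le[OF i True] size[OF A] ordIso_ordLeq_trans by blast
    then show ?thesis using True unc[OF A] by (intro exI[of _ A]) (simp add: ok_def)
  next
    case no: False
    show ?thesis
    proof (cases "|P| \<le>o |T i| \<and> countable (A \<inter> P)")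
      case True
      \<comment> \<open>The part to be avoided has size at most \<open>|T i|\<close>:
        \<open>A\<close> meets each of the at most \<open>|T i|\<close> active sets in a finite set.
        Since \<open>|A|\<close> is at least \<open>|L|\<close>, enough of \<open>A\<close>
        remains.\<close>
      define B where "B = (A \<inter> P) \<union> (\<Union>C\<in>active P. A \<inter> C)"
      have "finite (A \<inter> C)" if "C \<in> active P" for C
        using ad A that True by (auto simp: active_def pairwise_def)
      then have "|A \<inter> C| \<le>o |T i|" if "C \<in> active P" for C
        using that by (intro countable_le_infinite[OF countable_finite infinite_T[OF i]])
      moreover have "|active P| \<le>o |T i|"
        unfolding active_def using True
        by (intro card_uncountable_traces[OF ad infinite_T[OF i] cover[OF i]]) simp
      moreover have "|A \<inter> P| \<le>o |T i|" using True by (intro countable_le_infinite[OF _ infinite_T[OF i]]) simp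
      ultimately have "|B| \<le>o |T i|"
        unfolding B_def by (intro Un_le[OF infinite_T[OF i]] UN_le[OF infinite_T[OF i]])
      moreover have L: "|L| \<le>o |A|"
      proof -
        have "|L| \<le>o |K|" using no card_le_or_less[of L K] by blast
        then show ?thesis using ordLeq_ordIso_trans[OF _ ordIso_symmetric[OF size[OF A]]] by blast
      qed
      ultimately have "|B| <o |A|"
        using T_less[OF i] ordLeq_ordLess_trans ordLess_ordLeq_trans by metis
      then have "|A - B| =o |A|" using unc[OF A] by (intro Diff_same_card uncountable_infinite)
      then have "|T i| \<le>o |A - B|"
        using ordLess_ordLeq_trans[OF T_less[OF i] L] ordLess_imp_ordLeq ordLeq_ordIso_trans ordIso_symmetric
        by metis
      then obtain V where V: "V \<subseteq> A - B" "|T i| =o |V|"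
        using internalize_card_of_ordLeq2[of "T i" "A - B"] by blast
      have "\<not> countable V"
        using uncountable_mono[OF uncountable_T[OF i]] V(2) ordIso_iff_ordLeq by blast
      moreover have eq: "|V| =o |T i|" using V(2) by (rule ordIso_symmetric)
      moreover have "V \<subseteq> A" "V \<inter> P = {}" "V \<inter> \<Union>(active P) = {}" using V(1) by (auto simp: B_def)
      ultimately show ?thesis using no ordIso_imp_ordLeq[OF eq] by (intro exI[of _ V]) (simp add: ok_def)
    next
      case False
      then show ?thesis by (intro exI[of _ "{}"]) (auto simp: ok_def card_of_empty)
    qed
  qed
  define u where "u i P A = (SOME V. ok i P A V)" for i P A
  have u: "ok i P A (u i P A)" if "i \<in> Field W" "A \<in> \<A>" for i P A
    unfolding u_def using ok[OF that] by (rule someI_ex)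
  have u_sub: "u i P A \<subseteq> A" and u_card: "|u i P A| \<le>o |T i|" if "i \<in> Field W" "A \<in> \<A>" for i P A
    using u[OF that, of P] by (simp_all add: ok_def)
  have u_prop: "\<not> countable (u i P A) \<and> (if |K| <o |L| then u i P A = A
       else u i P A \<inter> P = {} \<and> u i P A \<inter> \<Union>(active P) = {} \<and> |u i P A| =o |T i| )"
    if "i \<in> Field W" "A \<in> \<A>" "|P| \<le>o |T i|" "countable (A \<inter> P)" for i P A
    using u[OF that(1,2), of P] that(3,4) by (simp add: ok_def)
  have r_in: "r i \<in> \<A>" if "i \<in> Field W" for i using imageI[OF that, of r] r by simp
  have "\<exists>U. \<forall>i\<in>Field W. below W U i \<subseteq> U i \<and> |U i| \<le>o |T i| \<and>
    (\<forall>A\<in>\<A>. \<not> countable (A \<inter> U i) \<or> (\<exists>n. infinite (A \<inter> Z U i n)) \<or> A = r i \<longrightarrow>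
      u i (below W U i) A \<subseteq> U i)"
    by (rule chain_exists[OF ad u_card r_in])
  then obtain U where U: "\<forall>i\<in>Field W. below W U i \<subseteq> U i \<and> |U i| \<le>o |T i| \<and>
    (\<forall>A\<in>\<A>. \<not> countable (A \<inter> U i) \<or> (\<exists>n. infinite (A \<inter> Z U i n)) \<or> A = r i \<longrightarrow>
      u i (below W U i) A \<subseteq> U i)" ..
  have U_below: "below W U i \<subseteq> U i" and U_card: "|U i| \<le>o |T i|" if "i \<in> Field W" for i
    using bspec[OF U that] by (simp_all only:)
  have U_u: "u i (below W U i) A \<subseteq> U i" if "i \<in> Field W" "A \<in> \<A>"
    "\<not> countable (A \<inter> U i) \<or> (\<exists>n. infinite (A \<inter> Z U i n)) \<or> A = r i" for i A
    using bspec[OF U that(1)] that(2,3) by (simp only:)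
  define P where "P i = below W U i" for i
  have P_card: "|P i| \<le>o |T i|" if "i \<in> Field W" for i
    unfolding P_def using card_below[OF that] U_card underS_Field by blast
  have P_U: "P i \<subseteq> U i" if "i \<in> Field W" for i using U_below[OF that] by (simp add: P_def)
  have U_P: "U j \<subseteq> P i" if "j \<in> underS W i" for i j using that by (auto simp: P_def)
  note u_prop = u_prop[OF _ _ P_card]
  \<comment> \<open>The trace is uncountable either on \<open>P i\<close> already or through the
    uncountable part \<open>u i (P i) A\<close> added at stage \<open>i\<close>.\<close>
  have meets: "\<not> countable (A \<inter> U i)"
    if "i \<in> Field W" "A \<in> \<A>" "(\<exists>n. infinite (A \<inter> Z U i n)) \<or> A = r i" for i A
  proof (cases "countable (A \<inter> P i)")
    case True
    have "u i (P i) A \<subseteq> A \<inter> U i" using U_u[OF that(1,2)] that u_sub by (auto simp: P_def)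
    then show ?thesis using u_prop[OF that(1,2,1) True] countable_subset by blast
  next
    case False
    then show ?thesis using P_U[OF that(1)] countable_subset[of "A \<inter> P i" "A \<inter> U i"] by blast
  qed
  \<comment> \<open>The split is on the cofinality below \<open>i\<close>. If it is uncountable,
    \<open>capture\<close> and \<open>meets\<close> apply; otherwise a countable cofinal
    \<open>J\<close> covers \<open>P i\<close> by countably many \<open>U k\<close>, and the trace
    on one of them is uncountable.\<close>
  have earlier: "\<exists>j\<in>underS W i. \<not> countable (A \<inter> U j)"
    if i: "i \<in> Field W" and A: "A \<in> \<A>" and AP: "\<not> countable (A \<inter> P i)" for i A
  proof (cases "\<forall>J. J \<subseteq> underS W i \<longrightarrow> countable J \<longrightarrow> (\<exists>k\<in>underS W i. J \<subseteq> underS W k)")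
    case True
    have "\<exists>k\<in>underS W i. \<exists>n. infinite (A \<inter> Z U k n)"
      using i U_below U_card _ AP[unfolded P_def] by (rule capture) (use True in blast)+
    then show ?thesis using meets[OF underS_Field A] by blast
  next
    case False
    then obtain J where J: "J \<subseteq> underS W i" "countable J" and nb: "\<And>k. k \<in> underS W i \<Longrightarrow> \<not> J \<subseteq> underS W k"
      by blast
    have "P i \<subseteq> (\<Union>k\<in>J. U k)"
    proof
      fix x assume "x \<in> P i"
      then obtain j where j: "j \<in> underS W i" "x \<in> U j" by (auto simp: P_def)
      then obtain k where k: "k \<in> J" "k \<notin> underS W j" using nb by blast
      then have "(j, k) \<in> W" using not_underS[of k j] J(1) j(1) underS_Field by blast
      then show "x \<in> (\<Union>k\<in>J. U k)" using below_mono[OF U_below] j(2) k(1) by blast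
    qed
    then have sub: "A \<inter> P i \<subseteq> (\<Union>k\<in>J. A \<inter> U k)" by blast
    have "\<exists>k\<in>J. \<not> countable (A \<inter> U k)"
    proof (rule ccontr)
      assume "\<not> ?thesis"
      then have "countable (\<Union>k\<in>J. A \<inter> U k)" using J(2) by (intro countable_UN) auto
      then show False using AP countable_subset[OF sub] by blast
    qed
    then show ?thesis using J(1) by blast
  qed
  define layer where "layer i = {A\<in>\<A>. \<not> countable (A \<inter> U i) \<and> countable (A \<inter> P i)}" for i
  define X where "X i = U i - P i - \<Union>(active (P i))" for i
  have layer_exists: "\<exists>k. (k, j) \<in> W \<and> A \<in> layer k"
    if j: "j \<in> Field W" and A: "A \<in> \<A>" "\<not> countable (A \<inter> U j)" for j A
  proof -
    define S where "S = {i\<in>Field W. \<not> countable (A \<inter> U i)}"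
    have S: "S \<subseteq> Field W" "j \<in> S" using j A by (auto simp: S_def)
    define k where "k = wo.minim S"
    have k: "k \<in> S" unfolding k_def using S by (intro wo.minim_in) auto
    have least: "(k, i) \<in> W" if "i \<in> S" for i unfolding k_def using wo.minim_least[OF S(1) that] .
    have "countable (A \<inter> P k)"
    proof (rule ccontr)
      assume "\<not> countable (A \<inter> P k)"
      then obtain i where i: "i \<in> underS W k" "\<not> countable (A \<inter> U i)"
        using earlier[of k A] k A by (auto simp: S_def)
      then have "(k, i) \<in> W" using least underS_Field by (auto simp: S_def)
      then show False using i(1) wo.ANTISYM by (auto simp: underS_def antisym_def)
    qed
    then show ?thesis using k least[OF S(2)] A by (auto simp: S_def layer_def)
  qed
  \<comment> \<open>These are the sizes of the traces on layer \<open>i\<close>: whole sets lose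
    only a countable part, while in the other case the added part of size \<open>|T i|\<close>
    survives and \<open>U i\<close> bounds the trace from above.\<close>
  define K' where "K' i = (if |K| <o |L| then K else T i)" for i
  have layer_size: "|A \<inter> X i| =o |K' i|" if i: "i \<in> Field W" and A: "A \<in> layer i" for i A
  proof -
    have A': "A \<in> \<A>" "\<not> countable (A \<inter> U i)" "countable (A \<inter> P i)" using A by (auto simp: layer_def)
    have uU: "u i (P i) A \<subseteq> U i" using U_u[OF i A'(1)] A'(2) by (simp add: P_def)
    note up = u_prop[OF i A'(1) i A'(3)]
    show ?thesis
    proof (cases "|K| <o |L|")
      case True
      \<comment> \<open>When whole sets are added, each active set was swallowed at its own earlier
        layer, so removing the active sets from \<open>U i\<close> costs nothing beyond
        \<open>P i\<close>.\<close>
      have "C \<subseteq> P i" if C: "C \<in> active (P i)" for C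
      proof -
        obtain j where j: "j \<in> underS W i" "\<not> countable (C \<inter> U j)"
          using earlier[OF i] C by (auto simp: active_def)
        then obtain k where k: "(k, j) \<in> W" "C \<in> layer k"
          using layer_exists[OF underS_Field[OF j(1)] _ j(2)] C by (auto simp: active_def)
        have kF: "k \<in> Field W" using k(1) by (auto simp: Field_def)
        have C': "C \<in> \<A>" "countable (C \<inter> P k)" "\<not> countable (C \<inter> U k)" using k(2) by (auto simp: layer_def)
        have "C = u k (P k) C" using u_prop[OF kF C'(1) kF C'(2)] True by simp
        also have "\<dots> \<subseteq> U k" using U_u[OF kF C'(1)] C'(3) by (simp add: P_def)
        also have "\<dots> \<subseteq> U j" using below_mono[OF U_below k(1)] .
        also have "\<dots> \<subseteq> P i" using U_P[OF j(1)] .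
        finally show ?thesis .
      qed
      moreover have "A \<subseteq> U i" using up True uU by simp
      ultimately have "A \<inter> X i = A - (A \<inter> P i)" by (auto simp: X_def)
      moreover have "|A \<inter> P i| <o |A|"
        using A'(3) uncountable_mono[OF unc[OF A'(1)]] card_le_or_less[of A] by blast
      ultimately have "|A \<inter> X i| =o |A|"
        using Diff_same_card[OF uncountable_infinite[OF unc[OF A'(1)]]] by simp
      then show ?thesis using size[OF A'(1)] True ordIso_transitive by (auto simp: K'_def)
    next
      case False
      then have V: "u i (P i) A \<inter> P i = {}" "u i (P i) A \<inter> \<Union>(active (P i)) = {}" "|u i (P i) A| =o |T i|"
        using up by simp_all
      have "u i (P i) A \<subseteq> A \<inter> X i" using V(1,2) uU u_sub[OF i A'(1)] by (auto simp: X_def)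
      then have "|T i| \<le>o |A \<inter> X i|"
        using ordIso_ordLeq_trans[OF ordIso_symmetric[OF V(3)] card_of_mono1] by blast
      moreover have "|A \<inter> X i| \<le>o |T i|"
        by (rule ordLeq_transitive[OF card_of_mono1 U_card[OF i]]) (auto simp: X_def)
      ultimately show ?thesis using False by (simp add: K'_def ordIso_iff_ordLeq)
    qed
  qed
  have "colourable ((\<lambda>A. A \<inter> X i) ` layer i)" if i: "i \<in> Field W" for i
  proof (rule IH[OF i])
    show "\<not> countable (K' i)" using K uncountable_T[OF i] by (simp add: K'_def)
    show "|K' i| \<le>o |T i|" using K_le[OF i] by (auto simp: K'_def card_of_mono1)
    show "pairwise (\<lambda>A B. finite (A \<inter> B)) ((\<lambda>A. A \<inter> X i) ` layer i)"
    proof (rule pairwiseI)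
      fix B C assume "B \<in> (\<lambda>A. A \<inter> X i) ` layer i" "C \<in> (\<lambda>A. A \<inter> X i) ` layer i" "B \<noteq> C"
      then obtain B' C' where "B' \<in> \<A>" "C' \<in> \<A>" "B' \<noteq> C'" "B \<inter> C \<subseteq> B' \<inter> C'"
        by (auto simp: layer_def)
      then show "finite (B \<inter> C)"
        using pairwiseD[OF ad, of B' C'] finite_subset[of "B \<inter> C" "B' \<inter> C'"] by simp
    qed
    have "|layer i| \<le>o |T i|"
      by (rule ordLeq_transitive[OF card_of_mono1
            card_uncountable_traces[OF ad infinite_T[OF i] cover[OF i U_card[OF i]]]])
         (auto simp: layer_def)
    then show "|(\<lambda>A. A \<inter> X i) ` layer i| \<le>o |T i|" by (rule ordLeq_transitive[OF card_of_image])
    show "|B| =o |K' i|" if "B \<in> (\<lambda>A. A \<inter> X i) ` layer i" for B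
      using that layer_size[OF i] by auto
  qed
  then have "\<exists>f. \<forall>i\<in>Field W. range (f i) \<subseteq> omega1 \<and>
      (\<forall>A\<in>layer i. countable (omega1 - I_f (f i) omega1 (A \<inter> X i)))"
    unfolding colourable_def by (intro bchoice) auto
  then obtain f where F: "\<forall>i\<in>Field W. range (f i) \<subseteq> omega1 \<and>
      (\<forall>A\<in>layer i. countable (omega1 - I_f (f i) omega1 (A \<inter> X i)))" ..
  have f: "range (f i) \<subseteq> omega1"
    "A \<in> layer i \<Longrightarrow> countable (omega1 - I_f (f i) omega1 (A \<inter> X i))" if "i \<in> Field W" for i A
    using bspec[OF F that] by (simp_all only:)
  have X_later: "X j \<inter> U i = {}" if "i \<in> underS W j" for i j
    using U_P[OF that] by (auto simp: X_def)
  have cmp: "i \<in> underS W j \<or> j \<in> underS W i" if "i \<in> Field W" "j \<in> Field W" "i \<noteq> j" for i j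
    using wo.TOTALS that by (auto simp: underS_def)
  show ?thesis
    unfolding colourable_def
  proof (rule glue_colourings[where I = "Field W" and X = X and f = f])
    show "omega1 \<noteq> {}" by (rule infinite_imp_nonempty[OF infinite_omega1])
    show "X i \<inter> X j = {}" if "i \<in> Field W" "j \<in> Field W" "i \<noteq> j" for i j
    proof -
      have "X i \<subseteq> U i" "X j \<subseteq> U j" by (auto simp: X_def)
      then show ?thesis using cmp[OF that] X_later[of i j] X_later[of j i] by blast
    qed
    show "range (f i) \<subseteq> omega1" if "i \<in> Field W" for i using f(1)[OF that] .
    fix A assume A: "A \<in> \<A>"
    obtain j where j: "j \<in> Field W" "A = r j" using A r by blast
    then obtain i where i: "(i, j) \<in> W" "A \<in> layer i" using layer_exists[OF j(1) A] meets[OF j(1) A] by blast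
    have iF: "i \<in> Field W" using i(1) by (auto simp: Field_def)
    have AU: "\<not> countable (A \<inter> U i)" and AP: "countable (A \<inter> P i)" using i(2) by (auto simp: layer_def)
    \<comment> \<open>A layer before \<open>i\<close> lies inside \<open>P i\<close>. For a layer
      \<open>k\<close> after \<open>i\<close>, the set \<open>A\<close> is active on
      \<open>P k\<close>, and \<open>X k\<close> was made to avoid it.\<close>
    have "A \<inter> X k \<subseteq> A \<inter> P i" if k: "k \<in> Field W" "k \<noteq> i" for k
    proof (cases "k \<in> underS W i")
      case True
      then show ?thesis using U_P by (auto simp: X_def)
    next
      case False
      then have "i \<in> underS W k" using cmp[OF k(1) iF k(2)] by blast
      then have "\<not> countable (A \<inter> P k)"
        using AU U_P countable_subset[of "A \<inter> U i" "A \<inter> P k"] by blast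
      then have "A \<in> active (P k)" using A by (simp add: active_def)
      then show ?thesis by (auto simp: X_def)
    qed
    then have "A \<inter> (\<Union>k\<in>Field W - {i}. X k) \<subseteq> A \<inter> P i" by blast
    then have "countable (A \<inter> (\<Union>k\<in>Field W - {i}. X k))" using AP countable_subset by blast
    then show "\<exists>i\<in>Field W. countable (omega1 - I_f (f i) omega1 (A \<inter> X i)) \<and>
        countable (A \<inter> (\<Union>j\<in>Field W - {i}. X j))"
      using f(2)[OF iF i(2)] iF by blast
  qed
qed

end

section \<open>Countable powers\<close>

lemma card_under_less:
  assumes "infinite M" "a \<in> M"
  shows "|under |M| a| <o |M|"
proof -
  have "|underS |M| a| <o |M|"
    using assms(2) by (intro card_of_underS card_of_Card_order) (simp add: Field_card_of)
  moreover have "|{a}| <o |M|"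
    using card_le_or_less[of M "{a}"] card_of_ordLeq_finite[of M "{a}"] assms(1) by blast
  ultimately have "|underS |M| a \<union> {a}| <o |M|"
    using assms(1) by (intro card_of_Un_ordLess_infinite)
  moreover have "under |M| a \<subseteq> underS |M| a \<union> {a}" by (auto simp: under_def underS_def)
  ultimately show ?thesis by (metis card_of_mono1 ordLeq_ordLess_trans)
qed

lemma cofinal_inD: "cofinal_in |M| S \<Longrightarrow> M \<subseteq> (\<Union>s\<in>S. under |M| s)"
  by (auto simp: cofinal_in_def under_def Field_card_of)

lemma finite_not_cofinal:
  assumes M: "infinite M" and "finite S"
  shows "\<not> cofinal_in |M| S"
proof
  assume cof: "cofinal_in |M| S"
  have "|\<Union>s\<in>F. under |M| s| <o |M|" if "F \<subseteq> S" for F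
    using finite_subset[OF that \<open>finite S\<close>] that
  proof (induction F rule: finite_induct)
    case empty
    then show ?case
      using card_le_or_less[of M "{}"] card_of_ordLeq_finite[of M "{}"] M by auto
  next
    case (insert s F)
    then have "s \<in> M" using cof by (auto simp: cofinal_in_def Field_card_of)
    with insert M show ?case
      by (auto intro!: card_of_Un_ordLess_infinite card_under_less)
  qed
  from ordLeq_ordLess_trans[OF card_of_mono1[OF cofinal_inD[OF cof]] this[OF subset_refl]]
  show False by (simp add: ordLess_irreflexive)
qed

text \<open>Finite sets are never cofinal in an infinite cardinal, so failing to have cofinality
  omega rules out every countable cofinal set; by totality, a set that is not cofinal is strictly
  bounded.\<close>

lemma not_cf_omega_bounded:
  assumes M: "infinite M" "\<not> cf_omega M" and S: "S \<subseteq> M" "countable S"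
  shows "\<exists>a\<in>M. S \<subseteq> underS |M| a"
proof -
  interpret wo_rel "|M|" by (simp add: wo_rel_def card_of_Well_order)
  have "\<not> cofinal_in |M| S"
    using M S(2) finite_not_cofinal[OF M(1)] unfolding cf_omega_def by blast
  then obtain a where a: "a \<in> M" "\<And>b. b \<in> S \<Longrightarrow> (a, b) \<notin> |M|"
    using S(1) by (auto simp: cofinal_in_def Field_card_of)
  have "S \<subseteq> underS a"
  proof
    fix b assume b: "b \<in> S"
    then have "(b, a) \<in> |M|" using TOTALS a S(1) by (auto simp: Field_card_of)
    then show "b \<in> underS a" using a(2)[OF b] by (auto simp: underS_def)
  qed
  then show ?thesis using a(1) by blast
qed

lemma cf_omega_countable:
  assumes "infinite M" "countable M"
  shows "cf_omega M"
proof -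
  interpret wo_rel "|M|" by (simp add: wo_rel_def card_of_Well_order)
  have "cofinal_in |M| M"
    using REFL by (auto simp: cofinal_in_def Field_card_of refl_on_def)
  then show ?thesis using assms finite_not_cofinal[OF assms(1)] unfolding cf_omega_def by blast
qed

lemma cf_omega_singular:
  assumes "\<not> countable M" "cf_omega M"
  shows "singular_card M"
proof -
  obtain S where S: "cofinal_in |M| S" "countable S" using assms(2) by (auto simp: cf_omega_def)
  have "|S| <o |M|"
    using uncountable_mono[OF assms(1)] S(2) card_le_or_less[of M S] by blast
  then show ?thesis using S(1) unfolding singular_card_def by blast
qed

text \<open>Initial segments of the successor have size at most \<open>|E|\<close>, and countably
  many of them cover at most \<open>|E|\<close> points.\<close>

lemma cardSuc_not_cf_omega:
  assumes E: "infinite E" and T: "|T| =o cardSuc |E|"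
  shows "\<not> cf_omega T"
proof
  assume "cf_omega T"
  then obtain S where S: "cofinal_in |T| S" "countable S" by (auto simp: cf_omega_def)
  have ET: "|E| <o |T|"
    using cardSuc_greater[OF card_of_Card_order] ordIso_symmetric[OF T] by (rule ordLess_ordIso_trans)
  then have "infinite T"
    using E card_of_ordLeq_finite[OF ordLess_imp_ordLeq] by blast
  have "|under |T| s| \<le>o |E|" if "s \<in> S" for s
  proof -
    have "s \<in> T" using S(1) that by (auto simp: cofinal_in_def Field_card_of)
    from ordLess_ordIso_trans[OF card_under_less[OF \<open>infinite T\<close> this] T]
    show ?thesis unfolding cardSuc_ordLeq_ordLess[OF card_of_Card_order card_of_Card_order] .
  qed
  then have "|\<Union>s\<in>S. under |T| s| \<le>o |E|"
    by (intro UN_le[OF E] countable_le_infinite[OF S(2) E])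
  from ordLeq_transitive[OF card_of_mono1[OF cofinal_inD[OF S(1)]] this] ET
  show False using not_ordLess_ordLeq by blast
qed

lemma seqs_bounded:
  assumes M: "infinite M" "\<not> cf_omega M"
  shows "seqs M \<subseteq> (\<Union>a\<in>M. seqs (underS |M| a))"
proof
  fix s assume "s \<in> seqs M"
  then have "range s \<subseteq> M" by simp
  then obtain a where "a \<in> M" "range s \<subseteq> underS |M| a"
    using not_cf_omega_bounded[OF M, of "range s"] by auto
  then show "s \<in> (\<Union>a\<in>M. seqs (underS |M| a))" by auto
qed

section \<open>Countable powers below lambda under the two hypotheses\<close>

locale square_hypotheses =
  fixes lam :: "'l set"
  assumes uncountable_lam: "\<not> countable lam"
    and power_omega: "\<And>M :: 'l set. |M| <o |lam| \<Longrightarrow> cf_omega M \<Longrightarrow> |seqs M| =o cardSuc |M|"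
    and square: "\<And>M :: 'l set. |M| <o |lam| \<Longrightarrow> singular_card M \<Longrightarrow> cf_omega M \<Longrightarrow> square M"
begin

text \<open>Hypothesis (i) at the cardinal omega, realised by a countably infinite subset of
  \<open>lam\<close>, yields the continuum hypothesis.\<close>

lemma seqs_nat: "|seqs (UNIV :: nat set)| \<le>o cardSuc natLeq"
proof -
  obtain s :: "nat \<Rightarrow> 'l" where s: "inj s" "range s \<subseteq> lam"
    using infinite_countable_subset[OF uncountable_infinite[OF uncountable_lam]] by blast
  define N where "N = range s"
  have N: "infinite N" "countable N" using s(1) by (auto simp: N_def range_inj_infinite)
  have "|N| <o |lam|"
    using uncountable_mono[OF uncountable_lam] N(2) card_le_or_less[of lam N] by blast
  then have 1: "|seqs N| =o cardSuc |N|"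
    using cf_omega_countable[OF N] by (rule power_omega)
  have 2: "|N| \<le>o natLeq" using N(2) by (simp add: countable_iff_le_natLeq)
  have "|UNIV :: nat set| \<le>o |N|" using N(1) by (intro countable_le_infinite countableI_type)
  then have "|seqs (UNIV :: nat set)| \<le>o |seqs N|" by (rule seqs_mono)
  also have "|seqs N| \<le>o cardSuc |N|" using 1 by (rule ordIso_imp_ordLeq)
  also have "cardSuc |N| \<le>o cardSuc natLeq"
    using 2 cardSuc_mono_ordLeq[OF card_of_Card_order natLeq_Card_order] by blast
  finally show ?thesis .
qed

lemma seqs_countable: "countable Y \<Longrightarrow> \<not> countable M \<Longrightarrow> |seqs Y| \<le>o |M|"
proof -
  assume Y: "countable Y" and M: "\<not> countable M"
  have "|Y| \<le>o |UNIV :: nat set|" using Y by (intro countable_le_infinite) auto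
  then have "|seqs Y| \<le>o |seqs (UNIV :: nat set)|" by (rule seqs_mono)
  also note seqs_nat
  also have "cardSuc natLeq \<le>o |M|" using M by (simp add: uncountable_iff_omega1_le)
  finally show ?thesis .
qed

text \<open>Induction on \<open>|M|\<close>. Without cofinality omega every sequence is bounded, and
  each proper initial segment has at most \<open>|M|\<close> sequences, by induction or, if it is
  countable, by \<open>seqs_countable\<close>. For cofinality omega, \<open>power_omega\<close>
  applies.\<close>

lemma seqs_le_aux:
  "|M :: 'l set| <o |lam| \<Longrightarrow> \<not> countable M \<Longrightarrow>
    |seqs M| \<le>o cardSuc |M| \<and> (\<not> cf_omega M \<longrightarrow> |seqs M| \<le>o |M| )"
proof (induction M rule: wf_induct_rule[OF wf_inv_image[OF wf_ordLess, of card_of]])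
  case (1 M)
  have M: "infinite M" using 1(3) by (rule uncountable_infinite)
  have le: "|M| \<le>o cardSuc |M|" by (rule cardSuc_ordLeq[OF card_of_Card_order])
  have "|seqs M| \<le>o |M|" if cf: "\<not> cf_omega M"
  proof -
    have "|seqs (underS |M| a)| \<le>o |M|" if a: "a \<in> M" for a
    proof (cases "countable (underS |M| a)")
      case True
      then show ?thesis using 1(3) by (rule seqs_countable)
    next
      case False
      have less: "|underS |M| a| <o |M|"
        using a by (intro card_of_underS card_of_Card_order) (simp add: Field_card_of)
      have "|seqs (underS |M| a)| \<le>o cardSuc |underS |M| a|"
        using 1(1)[OF _ ordLess_transitive[OF less 1(2)] False] less by simp
      also have "cardSuc |underS |M| a| \<le>o |M|"
        using less by (intro cardSuc_least card_of_Card_order)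
      finally show ?thesis .
    qed
    then have "|\<Union>a\<in>M. seqs (underS |M| a)| \<le>o |M|"
      by (intro UN_le[OF M] card_of_mono1[OF subset_refl])
    then show ?thesis by (rule ordLeq_transitive[OF card_of_mono1[OF seqs_bounded[OF M cf]]])
  qed
  moreover have "|seqs M| \<le>o cardSuc |M|" if "cf_omega M"
    using power_omega[OF 1(2) that] by (rule ordIso_imp_ordLeq)
  ultimately show ?case using ordLeq_transitive[OF _ le] by blast
qed

lemma seqs_le: "|M :: 'l set| <o |lam| \<Longrightarrow> \<not> countable M \<Longrightarrow> \<not> cf_omega M \<Longrightarrow> |seqs M| \<le>o |M|"
  using seqs_le_aux by blast

text \<open>Cofinality omega of \<open>M\<close> does no harm here: an uncountable \<open>Y\<close>
  has at most \<open>|Y|^+ \<le> |M|\<close> sequences. \<open>Y\<close> is first copied into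
  \<open>M\<close>, because the hypotheses speak of sets over \<open>'l\<close>.\<close>

lemma seqs_le_of_less:
  fixes Y :: "'b set" and M :: "'l set"
  assumes M: "\<not> countable M" "|M| \<le>o |lam|" and Y: "|Y| <o |M|"
  shows "|seqs Y| \<le>o |M|"
proof (cases "countable Y")
  case True
  then show ?thesis using M(1) by (rule seqs_countable)
next
  case False
  obtain Y' where Y': "Y' \<subseteq> M" "|Y| =o |Y'|"
    using internalize_card_of_ordLeq2[of Y M] ordLess_imp_ordLeq[OF Y] by blast
  have less: "|Y'| <o |M|" using ordIso_symmetric[OF Y'(2)] Y by (rule ordIso_ordLess_trans)
  have "\<not> countable Y'" using False ordIso_imp_ordLeq[OF Y'(2)] by (rule uncountable_mono)
  then have "|seqs Y'| \<le>o cardSuc |Y'|"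
    using seqs_le_aux ordLess_ordLeq_trans[OF less M(2)] by blast
  also have "cardSuc |Y'| \<le>o |M|" using less by (intro cardSuc_least card_of_Card_order)
  finally show ?thesis by (rule ordLeq_transitive[OF seqs_mono[OF ordIso_imp_ordLeq[OF Y'(2)]]])
qed

end

section \<open>Filtrations whose level sizes are closed under countable powers\<close>

text \<open>Here the whole earlier part can serve as test set. For \<open>capture\<close>, a
  countably infinite part of the trace involves only countably many levels; these are bounded by
  some \<open>k\<close> before \<open>i\<close>, so that part lies in
  \<open>below W U k\<close>.\<close>

lemma filtration_below:
  assumes W: "Well_order W"
    and unc: "\<And>i. i \<in> Field W \<Longrightarrow> \<not> countable (T i)"
    and under: "\<And>i. i \<in> Field W \<Longrightarrow> |underS W i| \<le>o |T i|"
    and mono: "\<And>i j. (i, j) \<in> W \<Longrightarrow> |T i| \<le>o |T j|"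
    and pow: "\<And>i. i \<in> Field W \<Longrightarrow> |seqs (T i)| \<le>o |T i|"
  shows "filtration W T (\<lambda>(U :: 'i \<Rightarrow> 'b set) i n. below W U i)"
proof
  fix i and Y :: "'b set" assume "i \<in> Field W" "|Y| \<le>o |T i|"
  then have "|seqs Y| \<le>o |T i|" using ordLeq_transitive[OF seqs_mono pow] by blast
  then show "seq_covered Y (T i)" unfolding seq_covered_def by (intro exI[of _ "\<lambda>_. Y"]) auto
next
  fix i and U U' :: "'i \<Rightarrow> 'b set"
  assume "\<And>j. j \<in> underS W i \<Longrightarrow> U j = U' j"
  then show "(\<lambda>n. below W U i) = (\<lambda>n::nat. below W U' i)" by auto
next
  fix i n and U :: "'i \<Rightarrow> 'b set"
  assume i: "i \<in> Field W" and U: "\<And>j. j \<in> underS W i \<Longrightarrow> |U j| \<le>o |T j|"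
  have "|U j| \<le>o |T i|" if "j \<in> underS W i" for j
    using ordLeq_transitive[OF U[OF that] mono] that by (auto simp: underS_def)
  then have "|below W U i| \<le>o |T i|"
    by (intro UN_le[OF uncountable_infinite[OF unc[OF i]] under[OF i]])
  then show "|seqs (below W U i)| \<le>o |T i|" using ordLeq_transitive[OF seqs_mono pow[OF i]] by blast
next
  fix i and U :: "'i \<Rightarrow> 'b set" and A
  assume bounded: "\<And>J. J \<subseteq> underS W i \<Longrightarrow> countable J \<Longrightarrow> \<exists>k\<in>underS W i. J \<subseteq> underS W k"
    and A: "\<not> countable (A \<inter> below W U i)"
  obtain s :: "nat \<Rightarrow> 'b" where s: "inj s" "range s \<subseteq> A \<inter> below W U i"
    using infinite_countable_subset[OF uncountable_infinite[OF A]] by blast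
  have "\<exists>j\<in>underS W i. s n \<in> U j" for n using s(2) by (auto simp: image_subset_iff)
  then obtain j where j: "\<And>n. j n \<in> underS W i" "\<And>n. s n \<in> U (j n)" by metis
  obtain k where k: "k \<in> underS W i" "range j \<subseteq> underS W k"
    using bounded[of "range j"] j(1) by (auto simp: image_subset_iff)
  have "range s \<subseteq> A \<inter> below W U k" using s(2) k(2) j(2) by (auto simp: image_subset_iff)
  then have "infinite (A \<inter> below W U k)"
    using range_inj_infinite[OF s(1)] finite_subset by blast
  then show "\<exists>k\<in>underS W i. \<exists>n::nat. infinite (A \<inter> below W U k)" using k(1) by blast
qed (use W unc under mono in auto)

section \<open>Square sequences\<close>

text \<open>Proper initial segments of \<open>r\<close> embed onto proper initial segments of the
  initial ordinal \<open>|M|\<close>, which are smaller than \<open>M\<close>.\<close>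

lemma card_underS_less:
  assumes r: "Well_order r" "r \<le>o |M|" and b: "b \<in> Field r"
  shows "|underS r b| <o |M|"
proof -
  obtain f where f: "embed r |M| f" using r(2) by (auto simp: ordLeq_def)
  have "|underS r b| =o |underS |M| (f b)|"
    by (rule card_of_ordIsoI[OF embed_underS[OF r(1) f b]])
  also have "|underS |M| (f b)| <o |M|"
    using embed_in_Field[OF f b] by (intro card_of_underS card_of_Card_order)
  finally show ?thesis .
qed

lemma lt_iff_underS: "lt W b a \<longleftrightarrow> b \<in> underS W a"
  by (auto simp: lt_def underS_def)

text \<open>A bounded countable subset of a square club \<open>C i\<close> at a point of uncountable cofinality
  lies below a limit point \<open>k\<close> of \<open>C i\<close>, hence inside \<open>C k\<close>.\<close>

lemma square_limit_point:
  fixes W :: "'i rel" and C :: "'i \<Rightarrow> 'i set"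
  assumes W: "Well_order W"
    and C: "club_below W i (C i)" "Restr W (C i) \<le>o |M|"
      "\<And>b. lt W b i \<Longrightarrow> is_limit W b \<Longrightarrow> unbounded_below W b (C i) \<Longrightarrow> C b = C i \<inter> {c. lt W c b}"
    and bounded: "\<And>J. J \<subseteq> underS W i \<Longrightarrow> countable J \<Longrightarrow> \<exists>k\<in>underS W i. J \<subseteq> underS W k"
    and J: "J \<subseteq> C i" "countable J"
  shows "\<exists>k\<in>underS W i. J \<subseteq> C k \<and> C k \<subseteq> underS W k \<and> |C k| <o |M|"
proof -
  interpret wo: wo_rel W by (simp add: wo_rel_def W)
  have C_sub: "C i \<subseteq> underS W i" using C(1) by (auto simp: club_below_def lt_iff_underS)
  have trans: "x \<in> underS W z" if "x \<in> underS W y" "(y, z) \<in> W" for x y z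
    using that wo.TRANS wo.ANTISYM unfolding underS_def trans_def antisym_def by blast
  have trans': "x \<in> underS W z" if "(x, y) \<in> W" "y \<in> underS W z" for x y z
    using that wo.TRANS wo.ANTISYM unfolding underS_def trans_def antisym_def by blast
  have step: "\<exists>c\<in>C i. b \<in> underS W c" if b: "b \<in> underS W i" for b
  proof -
    obtain k where k: "k \<in> underS W i" "b \<in> underS W k" using bounded[of "{b}"] b by auto
    then obtain c where "c \<in> C i" "(k, c) \<in> W"
      using C(1) unfolding club_below_def unbounded_below_def lt_iff_underS by blast
    then show ?thesis using trans[OF k(2)] by blast
  qed
  obtain k0 where k0: "k0 \<in> underS W i" "J \<subseteq> underS W k0"
    using bounded[OF subset_trans[OF J(1) C_sub] J(2)] by blast
  obtain c0 where c0: "c0 \<in> C i" "k0 \<in> underS W c0" using step[OF k0(1)] by blast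
  \<comment> \<open>An increasing omega-sequence in \<open>C i\<close>, started at \<open>c0\<close>
    to lie above \<open>J\<close>. Its supremum, the least strict upper bound \<open>k\<close>
    below, is the required limit point.\<close>
  have "\<exists>c. \<forall>n. c n \<in> C i \<and> c n \<in> underS W (c (Suc n)) \<and> (n = 0 \<longrightarrow> c n = c0)"
  proof -
    have "\<exists>c. \<forall>n. (c n \<in> C i \<and> (n = 0 \<longrightarrow> c n = c0)) \<and> c n \<in> underS W (c (Suc n))"
    proof (rule dependent_nat_choice)
      show "\<exists>x. x \<in> C i \<and> (0 = (0::nat) \<longrightarrow> x = c0)" using c0 by blast
      fix x and n :: nat assume "x \<in> C i \<and> (n = 0 \<longrightarrow> x = c0)"
      then show "\<exists>y. (y \<in> C i \<and> (Suc n = 0 \<longrightarrow> y = c0)) \<and> x \<in> underS W y"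
        using step[of x] C_sub by blast
    qed
    then show ?thesis by blast
  qed
  then obtain c where c: "\<And>n. c n \<in> C i" "\<And>n. c n \<in> underS W (c (Suc n))" "c 0 = c0" by metis
  have "range c \<subseteq> underS W i" using c(1) C_sub by blast
  then obtain k1 where k1: "k1 \<in> underS W i" "range c \<subseteq> underS W k1" using bounded[of "range c"] by auto
  define S where "S = {k \<in> Field W. range c \<subseteq> underS W k}"
  have S: "S \<subseteq> Field W" "k1 \<in> S" using k1 by (auto simp: S_def underS_def Field_def)
  define k where "k = wo.minim S"
  have kS: "k \<in> S" unfolding k_def using S by (intro wo.minim_in) auto
  have k_least: "(k, b) \<in> W" if "b \<in> S" for b unfolding k_def using wo.minim_least[OF S(1) that] .
  have ck: "c n \<in> underS W k" for n using kS by (auto simp: S_def)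
  have ki: "k \<in> underS W i" using trans'[OF k_least[OF S(2)] k1(1)] .
  have between: "\<exists>n. (b, c n) \<in> W" if b: "b \<in> underS W k" for b
  proof (rule ccontr)
    assume neg: "\<not> ?thesis"
    have bF: "b \<in> Field W" using b by (auto simp: underS_def Field_def)
    have "c n \<in> underS W b" for n
    proof -
      have "c n \<in> Field W" using ck[of n] by (auto simp: underS_def Field_def)
      then show ?thesis using neg bF wo.TOTALS by (auto simp: underS_def)
    qed
    then have "b \<in> S" using bF by (auto simp: S_def)
    then show False using k_least[of b] b wo.ANTISYM by (auto simp: underS_def antisym_def)
  qed
  have lim: "is_limit W k"
    unfolding is_limit_def lt_iff_underS
  proof (intro conjI allI impI)
    show "k \<in> Field W" using kS by (auto simp: S_def)
    show "\<exists>b. b \<in> underS W k" using ck by blast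
    fix b assume "b \<in> underS W k"
    then obtain n where "(b, c n) \<in> W" using between by blast
    then have "b \<in> underS W (c (Suc n))" using trans' c(2) by blast
    then show "\<exists>d. b \<in> underS W d \<and> d \<in> underS W k" using ck by blast
  qed
  have unb: "unbounded_below W k (C i)"
    unfolding unbounded_below_def lt_iff_underS using between c(1) ck by blast
  have kC: "k \<in> C i" using C(1) ki lim unb unfolding club_below_def lt_iff_underS by blast
  have Ck: "C k = C i \<inter> underS W k"
    using C(3)[of k] ki lim unb by (auto simp: lt_iff_underS)
  have "J \<subseteq> underS W k"
  proof
    fix x assume "x \<in> J"
    then have "x \<in> underS W k0" using k0(2) by blast
    moreover have "(k0, c0) \<in> W" "(c0, k) \<in> W" using c0(2) ck[of 0] c(3) by (auto simp: underS_def)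
    ultimately show "x \<in> underS W k" using trans by blast
  qed
  \<comment> \<open>By coherence \<open>C k\<close> is a proper initial segment of
    \<open>C i\<close>, whose order type is at most the initial ordinal of \<open>M\<close>.\<close>
  moreover have "|C k| <o |M|"
  proof -
    have "Field (Restr W (C i)) = C i"
      using C_sub by (intro Refl_Field_Restr2 wo.REFL) (auto simp: underS_def Field_def)
    then have "|underS (Restr W (C i)) k| <o |M|"
      using card_underS_less[OF Well_order_Restr[OF W] C(2)] kC by simp
    moreover have "C k \<subseteq> underS (Restr W (C i)) k"
      using Ck kC by (auto simp: underS_def)
    ultimately show ?thesis using ordLeq_ordLess_trans[OF card_of_mono1] by blast
  qed
  ultimately show ?thesis using ki J(1) Ck by blast
qed

text \<open>For fixed \<open>n\<close>, the \<open>n\<close>-th pieces of all sets share one bound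
  below \<open>|M|\<close>. A union of fewer than \<open>|M|\<close> of them therefore stays below
  \<open>|M|\<close> and has few sequences, although \<open>|M|\<close> is a limit of countable
  cofinality.\<close>

lemma filtration_square:
  fixes M :: "'l set"
  assumes M: "\<not> countable M" and cf: "cf_omega M" and sq: "square M"
    and pow: "\<And>Y :: 'b set. |Y| <o |M| \<Longrightarrow> |seqs Y| \<le>o |M|"
  shows "\<exists>Z :: ('l set \<Rightarrow> 'b set) \<Rightarrow> 'l set \<Rightarrow> nat \<Rightarrow> 'b set. filtration (cardSuc |M| ) (\<lambda>_. M) Z"
proof -
  define W where "W = cardSuc |M|"
  have W: "Well_order W" unfolding W_def by (intro cardSuc_Well_order card_of_Card_order)
  have infM: "infinite M" using M by (rule uncountable_infinite)
  have under: "|underS W i| \<le>o |M|" if "i \<in> Field W" for i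
  proof -
    have "|underS W i| <o cardSuc |M|"
      using that unfolding W_def by (intro card_of_underS cardSuc_Card_order card_of_Card_order)
    then show ?thesis unfolding cardSuc_ordLeq_ordLess[OF card_of_Card_order card_of_Card_order] .
  qed
  obtain C where C: "\<And>a. is_limit W a \<Longrightarrow> club_below W a (C a) \<and> Restr W (C a) \<le>o |M| \<and>
      (\<forall>b. lt W b a \<and> is_limit W b \<and> unbounded_below W b (C a) \<longrightarrow> C b = C a \<inter> {c. lt W c b})"
    using sq unfolding square_def Let_def W_def by blast
  obtain S where S: "cofinal_in |M| S" "countable S" using cf by (auto simp: cf_omega_def)
  have "S \<noteq> {}" using finite_not_cofinal[OF infM, of S] S(1) by auto
  define s where "s = from_nat_into S"
  have s: "range s = S" using S(2) \<open>S \<noteq> {}\<close> by (simp add: s_def)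
  have sM: "s n \<in> M" for n using S(1) s by (auto simp: cofinal_in_def Field_card_of)
  \<comment> \<open>\<open>Y\<close> is injected into \<open>M\<close> and cut along a countable
    cofinal set. The injection depends on \<open>Y\<close> alone, so the pieces of
    \<open>below W U b\<close> are the same at every stage that uses them.\<close>
  define g where "g Y = (SOME h. inj_on h Y \<and> h ` Y \<subseteq> M)" for Y :: "'b set"
  have g: "inj_on (g Y) Y \<and> g Y ` Y \<subseteq> M" if "|Y| \<le>o |M|" for Y
    unfolding g_def using that[folded card_of_ordLeq] by (rule someI_ex)
  define D where "D Y n = {y\<in>Y. g Y y \<in> under |M| (s n)}" for Y n
  have D_UN: "Y \<subseteq> (\<Union>n. D Y n)" if "|Y| \<le>o |M|" for Y
  proof
    fix y assume y: "y \<in> Y"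
    then have "g Y y \<in> M" using g[OF that] by blast
    then obtain n where "g Y y \<in> under |M| (s n)" using cofinal_inD[OF S(1)] s by blast
    then show "y \<in> (\<Union>n. D Y n)" using y by (auto simp: D_def)
  qed
  have D_le: "|D Y n| \<le>o |under |M| (s n)|" if "|Y| \<le>o |M|" for Y n
    using inj_on_subset[OF conjunct1[OF g[OF that]], of "D Y n"]
    by (intro card_of_ordLeqI[of "g Y"]) (auto simp: D_def)
  have D_less: "|D Y n| <o |M|" if "|Y| \<le>o |M|" for Y n
    using D_le[OF that] card_under_less[OF infM sM] by (rule ordLeq_ordLess_trans)
  \<comment> \<open>A \<open>C i\<close> of full size contributes nothing; the points found by
    \<open>square_limit_point\<close> satisfy \<open>|C k| <o |M|\<close>. Intersecting with
    \<open>underS W i\<close> keeps \<open>Z\<close> local even at non-limits, where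
    \<open>C i\<close> is arbitrary.\<close>
  define Z where "Z U i n = (if |C i| <o |M| then \<Union>b\<in>C i \<inter> underS W i. D (below W U b) n else {})"
    for U :: "'l set \<Rightarrow> 'b set" and i n
  interpret wo: wo_rel W by (simp add: wo_rel_def W)
  have underS_trans: "underS W j \<subseteq> underS W i" if "j \<in> underS W i" for i j
    using that wo.TRANS wo.ANTISYM unfolding underS_def trans_def antisym_def by blast
  have underS_F: "j \<in> Field W" if "j \<in> underS W i" for i j
    using that by (auto simp: underS_def Field_def)
  have below_le: "|below W U i| \<le>o |M|" if "i \<in> Field W" "\<And>j. j \<in> underS W i \<Longrightarrow> |U j| \<le>o |M|"
    for U :: "'l set \<Rightarrow> 'b set" and i
    using that by (intro UN_le[OF infM under])
  have "filtration W (\<lambda>_. M) Z"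
  proof
    fix i and Y :: "'b set" assume "|Y| \<le>o |M|"
    then show "seq_covered Y M"
      unfolding seq_covered_def using D_UN pow[OF D_less] by (intro exI[of _ "D Y"]) blast
  next
    fix i and U U' :: "'l set \<Rightarrow> 'b set"
    assume eq: "\<And>j. j \<in> underS W i \<Longrightarrow> U j = U' j"
    have "below W U b = below W U' b" if "b \<in> underS W i" for b
      using eq underS_trans[OF that] by auto
    then show "Z U i = Z U' i" by (auto simp: Z_def fun_eq_iff)
  next
    fix i n and U :: "'l set \<Rightarrow> 'b set"
    assume i: "i \<in> Field W" and U: "\<And>j. j \<in> underS W i \<Longrightarrow> |U j| \<le>o |M|"
    have "|Z U i n| <o |M|"
    proof (cases "|C i| <o |M|")
      case True
      have "|C i \<inter> underS W i| <o |M|"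
        by (rule ordLeq_ordLess_trans[OF card_of_mono1 True]) auto
      moreover have "|D (below W U b) n| \<le>o |under |M| (s n)|" if "b \<in> C i \<inter> underS W i" for b
        using that underS_trans U by (intro D_le below_le underS_F[of b i]) auto
      ultimately have "|\<Union>b\<in>C i \<inter> underS W i. D (below W U b) n| <o |M|"
        by (rule UN_less[OF infM _ card_under_less[OF infM sM]])
      then show ?thesis using True by (simp add: Z_def)
    next
      case False
      have "|{} :: 'b set| <o |M|"
        using card_le_or_less[of M "{} :: 'b set"] card_of_ordLeq_finite[of M "{} :: 'b set"] infM by auto
      then show ?thesis using False by (simp add: Z_def)
    qed
    then show "|seqs (Z U i n)| \<le>o |M|" by (rule pow)
  next
    fix i and U :: "'l set \<Rightarrow> 'b set" and A
    assume i: "i \<in> Field W" and U_below: "\<And>j. j \<in> Field W \<Longrightarrow> below W U j \<subseteq> U j"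
      and U: "\<And>j. j \<in> Field W \<Longrightarrow> |U j| \<le>o |M|"
      and bounded: "\<And>J. J \<subseteq> underS W i \<Longrightarrow> countable J \<Longrightarrow> \<exists>k\<in>underS W i. J \<subseteq> underS W k"
      and A: "\<not> countable (A \<inter> below W U i)"
    have lim: "is_limit W i"
      unfolding is_limit_def lt_iff_underS
    proof (intro conjI allI impI)
      show "i \<in> Field W" by (rule i)
      show "\<exists>b. b \<in> underS W i" using bounded[of "{}"] by auto
      show "\<exists>c. b \<in> underS W c \<and> c \<in> underS W i" if "b \<in> underS W i" for b
        using bounded[of "{b}"] that by auto
    qed
    note Ci = C[OF lim]
    have C_sub: "C i \<subseteq> underS W i" using Ci by (auto simp: club_below_def lt_iff_underS)
    have below_M: "|below W U b| \<le>o |M|" if "b \<in> C i" for b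
      using that C_sub underS_F U by (intro below_le) blast+
    have "below W U i \<subseteq> (\<Union>n. \<Union>b\<in>C i. D (below W U b) n)"
    proof
      fix x assume "x \<in> below W U i"
      then obtain j where j: "j \<in> underS W i" "x \<in> U j" by auto
      obtain k where k: "k \<in> underS W i" "j \<in> underS W k" using bounded[of "{j}"] j(1) by auto
      obtain b where b: "b \<in> C i" "(k, b) \<in> W"
        using Ci k(1) unfolding club_below_def unbounded_below_def lt_iff_underS by blast
      have "j \<in> underS W b"
        using k(2) b(2) wo.TRANS wo.ANTISYM unfolding underS_def trans_def antisym_def by blast
      then have "x \<in> below W U b" using j(2) by blast
      then show "x \<in> (\<Union>n. \<Union>b\<in>C i. D (below W U b) n)" using D_UN[OF below_M[OF b(1)]] b(1) by blast
    qed
    from uncountable_trace_piece[OF A this]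
    obtain n where n: "infinite (A \<inter> (\<Union>b\<in>C i. D (below W U b) n))" by blast
    obtain t :: "nat \<Rightarrow> 'b" where t: "inj t" "range t \<subseteq> A \<inter> (\<Union>b\<in>C i. D (below W U b) n)"
      using infinite_countable_subset[OF n] by blast
    \<comment> \<open>The points \<open>t m\<close> use only countably many indices
      \<open>b m\<close> of \<open>C i\<close>. These lie together in one earlier
      \<open>C k\<close>, whose \<open>n\<close>-th test set then contains all the
      \<open>t m\<close>.\<close>
    have "\<exists>b\<in>C i. t m \<in> D (below W U b) n" for m using t(2) by (auto simp: image_subset_iff)
    then obtain b where b: "\<And>m. b m \<in> C i" "\<And>m. t m \<in> D (below W U (b m)) n" by metis
    have "\<exists>k\<in>underS W i. range b \<subseteq> C k \<and> C k \<subseteq> underS W k \<and> |C k| <o |M|"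
      using Ci bounded b(1) by (intro square_limit_point[OF W]) auto
    then obtain k where k: "k \<in> underS W i" "range b \<subseteq> C k" "C k \<subseteq> underS W k" "|C k| <o |M|" by blast
    have "t m \<in> A \<inter> Z U k n" for m
    proof -
      have "b m \<in> C k \<inter> underS W k" using k(2,3) by blast
      then show ?thesis using b(2)[of m] t(2) k(4) by (auto simp: Z_def image_subset_iff)
    qed
    then have "range t \<subseteq> A \<inter> Z U k n" by auto
    then have "infinite (A \<inter> Z U k n)" using range_inj_infinite[OF t(1)] finite_subset by blast
    then show "\<exists>k\<in>underS W i. \<exists>n. infinite (A \<inter> Z U k n)" using k(1) by blast
  qed (use W M under card_of_mono1[OF subset_refl] in auto)
  then show ?thesis unfolding W_def by blast
qed

section \<open>Induction on the number of sets\<close>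

context square_hypotheses
begin

text \<open>Induction on \<open>|L|\<close>, with \<open>K\<close> arbitrary because traces on a
  layer may be smaller than the original sets. The cases are \<open>|L|\<close> at most omega1,
  \<open>|L|\<close> the successor of an uncountable \<open>|M|\<close>, and \<open>|L|\<close> a
  limit cardinal.\<close>

lemma colourable_le_lam:
  fixes L K :: "'l set" and \<A> :: "'b set set"
  assumes "|L| \<le>o |lam|" "\<not> countable L" "\<not> countable K" "|K| \<le>o |L|"
    "pairwise (\<lambda>A B. finite (A \<inter> B)) \<A>" "|\<A>| \<le>o |L|" "\<And>A. A \<in> \<A> \<Longrightarrow> |A| =o |K|"
  shows "colourable \<A>"
  using assms
proof (induction L arbitrary: K \<A> rule: wf_induct_rule[OF wf_inv_image[OF wf_ordLess, of card_of]])
  case (1 L)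
  note L = 1(2,3) and K = 1(4,5) and ad = 1(6) and card = 1(7) and size = 1(8)
  have IH: "colourable \<B>"
    if "|T| <o |L|" "\<not> countable K'" "|K'| \<le>o |T|" "pairwise (\<lambda>A B. finite (A \<inter> B)) \<B>" "|\<B>| \<le>o |T|"
      "\<And>B. B \<in> \<B> \<Longrightarrow> |B| =o |K'|" for T K' :: "'l set" and \<B> :: "'b set set"
    using that(1) ordLeq_transitive[OF ordLess_imp_ordLeq[OF that(1)] L(1)] uncountable_mono[OF that(2,3)] that(2-6)
    by (intro 1(1)[of T K' \<B>]) auto
  have infL: "infinite L" using L(2) by (rule uncountable_infinite)
  show ?case
  proof (cases "|L| \<le>o cardSuc natLeq")
    case True
    have K1: "|K| =o cardSuc natLeq"
      using ordLeq_transitive[OF K(2) True] K(1) by (simp add: ordIso_iff_ordLeq uncountable_iff_omega1_le)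
    show ?thesis
      using ad ordLeq_transitive[OF card True] ordIso_transitive[OF size K1] by (rule colourable_omega1)
  next
    case False
    then have w1L: "|omega1| <o |L|"
      using card_le_or_less[of L omega1] ordLeq_ordIso_trans[OF _ card_omega1] by blast
    show ?thesis
    proof (cases "\<exists>M :: 'l set. |M| <o |L| \<and> |L| \<le>o cardSuc |M|")
      case True
      then obtain M :: "'l set" where M: "|M| <o |L|" "|L| \<le>o cardSuc |M|" by blast
      have uncM: "\<not> countable M"
      proof
        assume "countable M"
        then have "cardSuc |M| \<le>o cardSuc natLeq"
          unfolding cardSuc_mono_ordLeq[OF card_of_Card_order natLeq_Card_order]
          by (simp add: countable_iff_le_natLeq)
        then show False using False ordLeq_transitive[OF M(2)] by blast
      qed
      have Mlam: "|M| <o |lam|" using M(1) L(1) by (rule ordLess_ordLeq_trans)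
      define W where "W = cardSuc |M|"
      have W: "Well_order W" unfolding W_def by (intro cardSuc_Well_order card_of_Card_order)
      have pow: "|seqs Y| \<le>o |M|" if "|Y| <o |M|" for Y :: "'b set"
        using uncM ordLess_imp_ordLeq[OF Mlam] that by (rule seqs_le_of_less)
      have "\<exists>Z :: ('l set \<Rightarrow> 'b set) \<Rightarrow> 'l set \<Rightarrow> nat \<Rightarrow> 'b set. filtration W (\<lambda>_. M) Z"
      \<comment> \<open>An uncountable \<open>M\<close> of cofinality omega is singular, so
        hypothesis (ii) supplies a square sequence; otherwise \<open>M\<close> has at most
        \<open>|M|\<close> sequences and the simple test sets suffice.\<close>
      proof (cases "cf_omega M")
        case True
        show ?thesis unfolding W_def
          using uncM True square[OF Mlam cf_omega_singular[OF uncM True] True] pow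
          by (rule filtration_square)
      next
        case False
        have "|underS W i| \<le>o |M|" if "i \<in> Field W" for i
        proof -
          have "|underS W i| <o cardSuc |M|"
            using that unfolding W_def by (intro card_of_underS cardSuc_Card_order card_of_Card_order)
          then show ?thesis unfolding cardSuc_ordLeq_ordLess[OF card_of_Card_order card_of_Card_order] .
        qed
        then show ?thesis
          by (intro exI[of _ "\<lambda>U i n. below W U i"] filtration_below W uncM seqs_le[OF Mlam uncM False]
              card_of_mono1[OF subset_refl])
      qed
      then obtain Z :: "('l set \<Rightarrow> 'b set) \<Rightarrow> 'l set \<Rightarrow> nat \<Rightarrow> 'b set"
        where "filtration W (\<lambda>_. M) Z" by blast
      then interpret filtration W "\<lambda>_. M" Z .
      have KM: "|K| \<le>o |M|" if "|K| <o |L|"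
        using ordLess_ordLeq_trans[OF that M(2)]
        unfolding cardSuc_ordLeq_ordLess[OF card_of_Card_order card_of_Card_order] .
      have LW: "|L| \<le>o |Field W|"
        unfolding W_def
        by (rule ordLeq_ordIso_trans[OF M(2) ordIso_symmetric[OF
              card_of_Field_ordIso[OF cardSuc_Card_order[OF card_of_Card_order]]]])
      show ?thesis
        using M(1) LW KM K(1) ad card size IH[OF M(1)] by (rule colourable_step)
    next
      case limit: False
      obtain Q where Q: "Q \<subseteq> L" "|omega1| =o |Q|"
        using internalize_card_of_ordLeq2[of omega1 L] ordLess_imp_ordLeq[OF w1L] by blast
      have uncQ: "\<not> countable Q" using uncountable_omega1 ordIso_imp_ordLeq[OF Q(2)] by (rule uncountable_mono)
      have QL: "|Q| <o |L|" using ordIso_symmetric[OF Q(2)] w1L by (rule ordIso_ordLess_trans)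
      \<comment> \<open>The level sizes \<open>|T i|\<close> will be \<open>|E i|^+\<close>: smaller
        than the limit cardinal \<open>|L|\<close>, and, being successors, not of cofinality omega.
        \<open>Q\<close> makes \<open>E i\<close> uncountable, and a small \<open>K\<close> is
        included so that whole members fit into a level.\<close>
      define E where "E i = underS |L| i \<union> Q \<union> (if |K| <o |L| then K else {})" for i
      have uncE: "\<not> countable (E i)" for i
        using uncQ countable_subset[of Q "E i"] by (auto simp: E_def)
      have E_less: "|E i| <o |L|" if "i \<in> L" for i
      proof -
        have "|underS |L| i| <o |L|"
          using that by (intro card_of_underS card_of_Card_order) (simp add: Field_card_of)
        moreover have "|if |K| <o |L| then K else {}| <o |L|"
          using card_le_or_less[of L "{} :: 'l set"] card_of_ordLeq_finite[of L "{} :: 'l set"] infL by auto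
        ultimately show ?thesis
          unfolding E_def using QL infL by (intro card_of_Un_ordLess_infinite)
      qed
      have "\<exists>T :: 'l set. |T| =o cardSuc |E i|" if "i \<in> L" for i
      proof -
        have "cardSuc |E i| \<le>o |L|"
          using E_less[OF that] by (intro cardSuc_least card_of_Card_order)
        moreover have F: "|Field (cardSuc |E i| )| =o cardSuc |E i|"
          by (intro card_of_Field_ordIso cardSuc_Card_order card_of_Card_order)
        ultimately have "|Field (cardSuc |E i| )| \<le>o |L|" using ordIso_ordLeq_trans by blast
        then obtain T :: "'l set" where "|Field (cardSuc |E i| )| =o |T|"
          using internalize_card_of_ordLeq2[of "Field (cardSuc |E i| )" L] by blast
        then show ?thesis using ordIso_transitive[OF ordIso_symmetric F] by blast
      qed
      then have "\<exists>T. \<forall>i\<in>L. |T i :: 'l set| =o cardSuc |E i|" by (intro bchoice) blast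
      then obtain T :: "'l \<Rightarrow> 'l set" where T: "\<And>i. i \<in> L \<Longrightarrow> |T i| =o cardSuc |E i|" by blast
      have ET: "|E i| \<le>o |T i|" if "i \<in> L" for i
        using cardSuc_ordLeq[OF card_of_Card_order] ordIso_symmetric[OF T[OF that]] by (rule ordLeq_ordIso_trans)
      have T_less: "|T i| <o |L|" if "i \<in> L" for i
      proof -
        have "cardSuc |E i| <o |L|"
          using limit E_less[OF that]
            ordLess_or_ordLeq[OF cardSuc_Well_order[OF card_of_Card_order[of "E i"]] card_of_Well_order[of L]]
          by blast
        then show ?thesis by (rule ordIso_ordLess_trans[OF T[OF that]])
      qed
      have uncT: "\<not> countable (T i)" if "i \<in> L" for i using uncE ET[OF that] by (rule uncountable_mono)
      interpret wo: wo_rel "|L|" by (simp add: wo_rel_def card_of_Well_order)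
      have "filtration |L| T (\<lambda>(U :: 'l \<Rightarrow> 'b set) i n. below |L| U i)"
      proof (rule filtration_below)
        fix i assume "i \<in> Field |L|"
        then have i: "i \<in> L" by (simp add: Field_card_of)
        show "\<not> countable (T i)" using uncT[OF i] .
        show "|underS |L| i| \<le>o |T i|"
          by (rule ordLeq_transitive[OF card_of_mono1 ET[OF i]]) (auto simp: E_def)
        have "\<not> cf_omega (T i)"
          using uncountable_infinite[OF uncE] T[OF i] by (rule cardSuc_not_cf_omega)
        then show "|seqs (T i)| \<le>o |T i|"
          using ordLess_ordLeq_trans[OF T_less[OF i] L(1)] uncT[OF i] by (intro seqs_le)
      next
        fix i j assume ij: "(i, j) \<in> |L|"
        then have "i \<in> Field |L|" "j \<in> Field |L|" by (auto intro: FieldI1 FieldI2)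
        then have F: "i \<in> L" "j \<in> L" by (simp_all add: Field_card_of)
        have "underS |L| i \<subseteq> underS |L| j"
          using ij wo.TRANS wo.ANTISYM unfolding underS_def trans_def antisym_def by blast
        then have "|E i| \<le>o |E j|" by (intro card_of_mono1) (auto simp: E_def)
        then have "cardSuc |E i| \<le>o cardSuc |E j|"
          unfolding cardSuc_mono_ordLeq[OF card_of_Card_order card_of_Card_order] .
        from ordIso_ordLeq_trans[OF T[OF F(1)] ordLeq_ordIso_trans[OF this ordIso_symmetric[OF T[OF F(2)]]]]
        show "|T i| \<le>o |T j|" .
      qed (rule card_of_Well_order)
      then interpret filtration "|L|" T "\<lambda>(U :: 'l \<Rightarrow> 'b set) i n. below |L| U i" .
      have KT: "|K| \<le>o |T i|" if "i \<in> L" "|K| <o |L|" for i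
        by (rule ordLeq_transitive[OF card_of_mono1 ET[OF that(1)]]) (use that(2) in \<open>auto simp: E_def\<close>)
      show ?thesis
        using T_less card_of_mono1[OF subset_refl] KT K(1) ad card size IH[OF T_less]
        by (rule colourable_step[unfolded Field_card_of])
    qed
  qed
qed

end

theorem theorem8p7:
  fixes lam :: "'l set" and K :: "'l set" and \<A> :: "'b set set"
  assumes uncountable: "\<not> countable lam"
    and hyp_i: "\<And>M :: 'l set. ordLess2 (card_of M) (card_of lam) \<Longrightarrow> cf_omega M \<Longrightarrow>
                  ordIso2 (card_of (BNF_Wellorder_Constructions.Func (UNIV :: nat set) M)) (cardSuc (card_of M))"
    and hyp_ii: "\<And>M :: 'l set. ordLess2 (card_of M) (card_of lam) \<Longrightarrow> singular_card M \<Longrightarrow>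
                  cf_omega M \<Longrightarrow> square M"
    and kappa_ge: "ordLeq3 (cardSuc natLeq) (card_of K)"
    and kappa_le: "ordLeq3 (card_of K) (card_of lam)"
    and sys: "is_system \<A> (card_of lam) (card_of K) natLeq"
  shows "\<exists>f :: 'b \<Rightarrow> nat set. f ` (\<Union>\<A>) \<subseteq> omega1 \<and>
           (\<forall>A\<in>\<A>. ordLess2 (card_of (omega1 - I_f f omega1 A)) (card_of omega1))"
proof -
  interpret square_hypotheses lam
    using uncountable hyp_i hyp_ii by unfold_locales (simp_all add: seqs_eq_Func)
  have "colourable \<A>"
  proof (rule colourable_le_lam)
    show "|lam| \<le>o |lam|" by (rule card_of_mono1[OF subset_refl])
    show "\<not> countable lam" by (rule uncountable)
    show "\<not> countable K" using kappa_ge by (simp add: uncountable_iff_omega1_le)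
    show "|K| \<le>o |lam|" by (rule kappa_le)
    show "pairwise (\<lambda>A B. finite (A \<inter> B)) \<A>"
      using sys by (auto simp: is_system_def pairwise_def finite_iff_ordLess_natLeq)
    show "|\<A>| \<le>o |lam|" using sys by (auto simp: is_system_def intro: ordIso_imp_ordLeq)
    show "|A| =o |K|" if "A \<in> \<A>" for A using sys that by (auto simp: is_system_def)
  qed
  then obtain f :: "'b \<Rightarrow> nat set" where f: "range f \<subseteq> omega1"
    "\<forall>A\<in>\<A>. countable (omega1 - I_f f omega1 A)"
    unfolding colourable_def by blast
  have "|omega1 - I_f f omega1 A| <o |omega1|" if "A \<in> \<A>" for A
    using bspec[OF f(2) that] by (rule countable_less_omega1)
  moreover have "f ` \<Union>\<A> \<subseteq> omega1" using f(1) by blast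
  ultimately show ?thesis by blast
qed

end
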